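(* Let $m\in\mathbb{N}$, let $E(x,y)=x^{2m}+y^{2m}$, and let $R(x,y)$ be a product of non-proportional real linear homogeneous factors of one of the forms $$x\prod_{i=1}^k(x^2-i^2y^2)\qquad\text{or}\qquad x\,\big(x-(k+1)y\big)\prod_{i=1}^k(x^2-i^2y^2),\qquad k\in\mathbb{N}.$$ Let $f(x,y)=E(x,y)R(x,y)$, and assume $f$ is hyperbolic. Then the foliations of the asymptotic curves of the surface $z=f(x,y)$ and those of the surface $z=R(x,y)$ are topologically equivalent.
   Context: $\mathbb{N}=\{1,2,3,\dots\}$. A homogeneous polynomial $h\in\mathbb{R}[x,y]$ of degree at least $2$ is hyperbolic if $h_{xx}h_{yy}-h_{xy}^2<0$ at every point of $\mathbb{R}^2\setminus\{(0,0)\}$. For such $h$, the second fundamental form $\mathrm{II}_h=h_{xx}dx^2+2h_{xy}dx\,dy+h_{yy}dy^2$ of the graph $z=h(x,y)$ has, at each point of $\mathbb{R}^2\setminus\{(0,0)\}$, two distinct null directions. These define two continuous line fields on $\mathbb{R}^2\setminus\{(0,0)\}$ (the fields of asymptotic directions, projected to the $xy$-plane along the $z$-axis). Their integral curves are the asymptotic curves, and they form two foliations of $\mathbb{R}^2\setminus\{(0,0)\}$ with a singularity at the origin. Topological equivalence of the asymptotic fields of two such polynomials means, in the paper's terms, that at the origin the number of separatrices of the corresponding fields is the same and the corresponding sectors are of the same type (parabolic, hyperbolic or elliptic). *)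

theory Defs
  imports "HOL-Analysis.Analysis"
begin

section \<open>Hyperbolic homogeneous polynomials\<close>

text \<open>Polynomials in \<open>\<real>[x,y]\<close> are represented by their polynomial functions.\<close>

definition homogeneous_polynomial :: "nat \<Rightarrow> (real \<Rightarrow> real \<Rightarrow> real) \<Rightarrow> bool" where
  "homogeneous_polynomial n h \<longleftrightarrow>
     (\<exists>c :: nat \<Rightarrow> real. \<forall>x y. h x y = (\<Sum>i\<le>n. c i * x ^ i * y ^ (n - i)))"

definition dx :: "(real \<Rightarrow> real \<Rightarrow> real) \<Rightarrow> real \<Rightarrow> real \<Rightarrow> real" where
  "dx h x y = deriv (\<lambda>s. h s y) x"

definition dy :: "(real \<Rightarrow> real \<Rightarrow> real) \<Rightarrow> real \<Rightarrow> real \<Rightarrow> real" where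
  "dy h x y = deriv (\<lambda>s. h x s) y"

definition hyperbolic_polynomial :: "(real \<Rightarrow> real \<Rightarrow> real) \<Rightarrow> bool" where
  "hyperbolic_polynomial h \<longleftrightarrow>
     (\<exists>n\<ge>2. homogeneous_polynomial n h) \<and>
     (\<forall>x y. (x, y) \<noteq> (0, 0) \<longrightarrow>
        dx (dx h) x y * dy (dy h) x y - (dy (dx h) x y)\<^sup>2 < 0)"

section \<open>The two fields of asymptotic directions\<close>

definition second_form ::
    "(real \<Rightarrow> real \<Rightarrow> real) \<Rightarrow> real \<times> real \<Rightarrow> real \<times> real \<Rightarrow> real" where
  "second_form h = (\<lambda>(x, y) (a, b).
     dx (dx h) x y * a\<^sup>2 + 2 * dy (dx h) x y * a * b + dy (dy h) x y * b\<^sup>2)"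

type_synonym line_field = "real \<times> real \<Rightarrow> (real \<times> real) set"

definition continuous_line_field_on :: "(real \<times> real) set \<Rightarrow> line_field \<Rightarrow> bool" where
  "continuous_line_field_on S L \<longleftrightarrow>
     (\<forall>p\<in>S. \<exists>U X. open U \<and> p \<in> U \<and> continuous_on (U \<inter> S) X \<and>
        (\<forall>q\<in>U \<inter> S. X q \<noteq> 0 \<and> L q = span {X q}))"

text \<open>On the punctured plane the conditions below determine the two fields up to their order:
  an indefinite quadratic form in the oriented plane orders its two null lines.
  The values of the fields at the origin are irrelevant.\<close>

definition asymptotic_fields ::
    "(real \<Rightarrow> real \<Rightarrow> real) \<Rightarrow> line_field \<Rightarrow> line_field \<Rightarrow> bool" where
  "asymptotic_fields h L1 L2 \<longleftrightarrow>
     continuous_line_field_on (- {0}) L1 \<and> continuous_line_field_on (- {0}) L2 \<and>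
     (\<forall>p. p \<noteq> 0 \<longrightarrow> L1 p \<noteq> L2 p \<and> {v. second_form h p v = 0} = L1 p \<union> L2 p)"

definition integral_curve :: "line_field \<Rightarrow> real set \<Rightarrow> (real \<Rightarrow> real \<times> real) \<Rightarrow> bool" where
  "integral_curve L I \<gamma> \<longleftrightarrow>
     (\<exists>\<gamma>'. continuous_on I \<gamma>' \<and>
        (\<forall>t\<in>I. \<gamma> t \<noteq> 0 \<and> (\<gamma> has_vector_derivative \<gamma>' t) (at t within I) \<and>
               \<gamma>' t \<noteq> 0 \<and> \<gamma>' t \<in> L (\<gamma> t)))"

section \<open>Sectors and separatrices at the origin\<close>

definition circle_point :: "real \<Rightarrow> real \<Rightarrow> real \<times> real" where
  "circle_point e a = (e * cos a, e * sin a)"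

text \<open>A piece of a leaf that joins the point at angle \<open>a\<close> of the circle of radius \<open>e\<close> to the
  origin inside the disc.\<close>

definition characteristic_curve ::
    "line_field \<Rightarrow> real \<Rightarrow> real \<Rightarrow> (real \<Rightarrow> real \<times> real) \<Rightarrow> bool" where
  "characteristic_curve L e a \<gamma> \<longleftrightarrow>
     integral_curve L {0<..1} \<gamma> \<and> \<gamma> 1 = circle_point e a \<and>
     (\<forall>t\<in>{0<..<1}. norm (\<gamma> t) < e) \<and> (\<gamma> \<longlongrightarrow> 0) (at_right 0)"

text \<open>The region cut out of the closed disc between the curves \<open>\<Gamma> i\<close> and \<open>\<Gamma> (i + 1)\<close>
  (cyclically): the component that touches the circle at the angles between \<open>\<alpha> i\<close> and
  \<open>\<alpha> (i + 1)\<close>.\<close>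

definition sector_region ::
    "real \<Rightarrow> nat \<Rightarrow> (nat \<Rightarrow> real) \<Rightarrow> (nat \<Rightarrow> real \<Rightarrow> real \<times> real) \<Rightarrow> nat \<Rightarrow> (real \<times> real) set" where
  "sector_region e n \<alpha> \<Gamma> i =
     connected_component_set (cball 0 e - {0} - (\<Union>j<n. \<Gamma> j ` {0<..1}))
       (circle_point e ((\<alpha> i + \<alpha> (Suc i)) / 2))"

datatype sector_type = Hyperbolic | Parabolic | Elliptic

text \<open>How the leaf through \<open>p\<close> behaves in a sector \<open>S\<close> of the disc of radius \<open>e\<close>: both ends
  reach the circle; one end reaches the circle and the other one tends to the origin; both ends
  tend to the origin.\<close>

definition crossing_leaf :: "line_field \<Rightarrow> real \<Rightarrow> (real \<times> real) set \<Rightarrow> real \<times> real \<Rightarrow> bool" where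
  "crossing_leaf L e S p \<longleftrightarrow>
     (\<exists>\<gamma>. integral_curve L {0..1} \<gamma> \<and> \<gamma> ` {0..1} \<subseteq> S \<and> p \<in> \<gamma> ` {0..1} \<and>
          norm (\<gamma> 0) = e \<and> norm (\<gamma> 1) = e)"

definition one_ended_leaf :: "line_field \<Rightarrow> real \<Rightarrow> (real \<times> real) set \<Rightarrow> real \<times> real \<Rightarrow> bool" where
  "one_ended_leaf L e S p \<longleftrightarrow>
     (\<exists>\<gamma>. integral_curve L {0<..1} \<gamma> \<and> \<gamma> ` {0<..1} \<subseteq> S \<and> p \<in> \<gamma> ` {0<..1} \<and>
          (\<gamma> \<longlongrightarrow> 0) (at_right 0) \<and> norm (\<gamma> 1) = e)"

definition loops :: "line_field \<Rightarrow> (real \<times> real) set \<Rightarrow> (real \<times> real) set set" where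
  "loops L S =
     {\<gamma> ` {0<..<1} | \<gamma>. integral_curve L {0<..<1} \<gamma> \<and> \<gamma> ` {0<..<1} \<subseteq> S \<and>
          (\<gamma> \<longlongrightarrow> 0) (at_right 0) \<and> (\<gamma> \<longlongrightarrow> 0) (at_left 1)}"

text \<open>Only the leaves through points close to the origin are constrained, so that the type of a
  sector does not depend on tangencies of the foliation with the circle. An elliptic sector is
  one with nested loops; loops that are too large for the disc appear in it as one-ended leaves.\<close>

fun has_sector_type ::
    "line_field \<Rightarrow> real \<Rightarrow> (real \<times> real) set \<Rightarrow> sector_type \<Rightarrow> bool" where
  "has_sector_type L e S Hyperbolic \<longleftrightarrow>
     (\<exists>\<delta>>0. \<forall>p\<in>S \<inter> ball 0 \<delta>. crossing_leaf L e S p)"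
| "has_sector_type L e S Parabolic \<longleftrightarrow>
     (\<exists>\<delta>>0. \<forall>p\<in>S \<inter> ball 0 \<delta>. one_ended_leaf L e S p)"
| "has_sector_type L e S Elliptic \<longleftrightarrow>
     loops L S \<noteq> {} \<and>
     (\<forall>A\<in>loops L S. \<forall>B\<in>loops L S.
        A = B \<or> A \<subseteq> inside (insert 0 B) \<or> B \<subseteq> inside (insert 0 A)) \<and>
     (\<exists>\<delta>>0. \<forall>p\<in>S \<inter> ball 0 \<delta>. p \<in> \<Union>(loops L S) \<or> one_ended_leaf L e S p)"

text \<open>A decomposition of the disc of radius \<open>e\<close> into sectors of the types \<open>ts\<close>, listed
  counterclockwise, that are bounded by the characteristic curves \<open>\<Gamma> i\<close>. The empty list stands
  for the case in which no leaf tends to the origin (a centre).\<close>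

definition sectorial_decomposition ::
    "line_field \<Rightarrow> real \<Rightarrow> (nat \<Rightarrow> real) \<Rightarrow> (nat \<Rightarrow> real \<Rightarrow> real \<times> real) \<Rightarrow> sector_type list \<Rightarrow> bool"
  where
  "sectorial_decomposition L e \<alpha> \<Gamma> ts \<longleftrightarrow>
     (let n = length ts in
      if n = 0 then \<not> (\<exists>a \<gamma>. characteristic_curve L e a \<gamma>)
      else (\<forall>i<n. \<alpha> i < \<alpha> (Suc i)) \<and> \<alpha> n = \<alpha> 0 + 2 * pi \<and>
           (\<forall>i<n. characteristic_curve L e (\<alpha> i) (\<Gamma> i)) \<and>
           (\<forall>i<n. \<forall>j<n. i \<noteq> j \<longrightarrow> \<Gamma> i ` {0<..1} \<inter> \<Gamma> j ` {0<..1} = {}) \<and>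
           (\<forall>i<n. has_sector_type L e (sector_region e n \<alpha> \<Gamma> i) (ts ! i)))"

text \<open>The separatrices are the characteristic curves that bound a hyperbolic sector. The curve
  \<open>\<Gamma> i\<close> lies between the sectors number \<open>i - 1\<close> (cyclically) and \<open>i\<close>.\<close>

definition separatrices ::
    "(nat \<Rightarrow> real \<Rightarrow> real \<times> real) \<Rightarrow> sector_type list \<Rightarrow> (real \<times> real) set set" where
  "separatrices \<Gamma> ts =
     {\<Gamma> i ` {0<..1} | i. i < length ts \<and>
        (ts ! i = Hyperbolic \<or> ts ! ((i + length ts - 1) mod length ts) = Hyperbolic)}"

text \<open>Since sectors are local objects, decompositions of arbitrarily small discs are required.
  The sectors correspond to each other in their cyclic order; the sector to start with is free,
  because \<open>\<alpha>\<close> and \<open>\<beta>\<close> may start at any of the bounding curves.\<close>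

definition same_sectors_at_origin :: "line_field \<Rightarrow> line_field \<Rightarrow> bool" where
  "same_sectors_at_origin L M \<longleftrightarrow>
     (\<forall>r>0. \<exists>e\<in>{0<..<r}. \<exists>d\<in>{0<..<r}. \<exists>\<alpha> \<beta> \<Gamma> \<Delta> ts us.
        sectorial_decomposition L e \<alpha> \<Gamma> ts \<and> sectorial_decomposition M d \<beta> \<Delta> us \<and>
        card (separatrices \<Gamma> ts) = card (separatrices \<Delta> us) \<and> ts = us)"

definition topologically_equivalent ::
    "(real \<Rightarrow> real \<Rightarrow> real) \<Rightarrow> (real \<Rightarrow> real \<Rightarrow> real) \<Rightarrow> bool" where
  "topologically_equivalent h g \<longleftrightarrow>
     (\<exists>L1 L2 M1 M2. asymptotic_fields h L1 L2 \<and> asymptotic_fields g M1 M2 \<and>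
        same_sectors_at_origin L1 M1 \<and> same_sectors_at_origin L2 M2)"

end

(* For a homogeneous h of degree n the polar form h = r^n F(t) turns the Hessian form, in the frame
   of the radial and angular directions, into n(n-1) F, (n-1) F', F'' + n F. The radial direction is
   asymptotic exactly at the zeros of F, and there it belongs to the first or to the second field
   according to the sign of F'. Hence each field has one radial leaf for every zero of F at which F'
   has the corresponding sign. Between two consecutive ones a leaf is a graph r = r(t), and h is
   strictly monotone along it; since F tends to 0 at both ends, r tends to infinity there, so the
   sector is hyperbolic. Thus the sectors depend only on the signs of F, which f and R share.
   That R is hyperbolic is the classical inequality (n-1) g'^2 - n g g'' > 0 for a product g of n
   pairwise non-proportional linear forms. *)

theory Submission
  imports Defs
begin

section \<open>Derivatives of homogeneous polynomials\<close>

text \<open>With the Hessian B of h, the rotation J by a right angle and r^2 = - det B, the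
  traceless matrix J^-1 B has the eigenvalues r and - r. Its eigenlines are null lines, because v .
  Jv = 0, and they are told apart globally by the sign in Bv = r Jv or Bv = - r Jv. Passing from h
  to - h exchanges them, so everything is done for the first field only. The monotonicity along
  leaves comes from Euler's identity Bp = (n-1) grad h(p): if Bv = r Jv, then (n-1) dh(v) = p . Bv =
  r p . Jv = - r det(p, v), so h decreases strictly along a leaf that turns counterclockwise. The
  field is invariant under dilations, so the logarithmic slope of a leaf depends on the angle only,
  and an antiderivative of it gives one leaf; its dilations fill the whole angle. Two points need
  care: the slope must stay finite at the intermediate zero of F, which is radial for the other
  field, and \<open>crossing_leaf\<close> asks for an arc inside the closed disc, so the leaf has to
  be cut where it first reaches the circle.\<close>

lemma dx_polynomial:
  fixes c :: "'i \<Rightarrow> real" and p q :: "'i \<Rightarrow> nat"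
  shows "dx (\<lambda>x y. \<Sum>i\<in>I. c i * x ^ p i * y ^ q i) =
    (\<lambda>x y. \<Sum>i\<in>I. (c i * real (p i)) * x ^ (p i - 1) * y ^ q i)"
  unfolding dx_def
  by (intro ext DERIV_imp_deriv) (auto intro!: derivative_eq_intros sum.cong)

lemma dy_polynomial:
  fixes c :: "'i \<Rightarrow> real" and p q :: "'i \<Rightarrow> nat"
  shows "dy (\<lambda>x y. \<Sum>i\<in>I. c i * x ^ p i * y ^ q i) =
    (\<lambda>x y. \<Sum>i\<in>I. (c i * real (q i)) * x ^ p i * y ^ (q i - 1))"
  unfolding dy_def
  by (intro ext DERIV_imp_deriv) (auto intro!: derivative_eq_intros sum.cong)

lemma homogeneous_polynomialE:
  assumes "homogeneous_polynomial n h"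
  obtains c where "h = (\<lambda>x y. \<Sum>i\<le>n. c i * x ^ i * y ^ (n - i))"
  using assms unfolding homogeneous_polynomial_def by (auto simp: fun_eq_iff)

lemma homogeneous_polynomial_dx:
  assumes "homogeneous_polynomial (Suc n) h"
  shows "homogeneous_polynomial n (dx h)"
proof -
  obtain c where h: "h = (\<lambda>x y. \<Sum>i\<le>Suc n. c i * x ^ i * y ^ (Suc n - i))"
    using homogeneous_polynomialE[OF assms] .
  show ?thesis
    unfolding homogeneous_polynomial_def h dx_polynomial
    by (rule exI[of _ "\<lambda>i. c (Suc i) * real (Suc i)"]) (simp only: sum.atMost_Suc_shift, simp)
qed

lemma homogeneous_polynomial_dy:
  assumes "homogeneous_polynomial (Suc n) h"
  shows "homogeneous_polynomial n (dy h)"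
proof -
  obtain c where h: "h = (\<lambda>x y. \<Sum>i\<le>Suc n. c i * x ^ i * y ^ (Suc n - i))"
    using homogeneous_polynomialE[OF assms] .
  show ?thesis
    unfolding homogeneous_polynomial_def h dy_polynomial
    by (rule exI[of _ "\<lambda>i. c i * real (Suc n - i)"]) simp
qed

text \<open>Stating the derivative rules for arbitrary index sets and exponents pays off here: a
  derivative has again the shape they expect. Truncated subtraction in the exponents is harmless,
  since the coefficient then has a factor 0.\<close>

lemma dx_dy_commute:
  assumes "homogeneous_polynomial n h"
  shows "dx (dy h) = dy (dx h)"
proof -
  obtain c where h: "h = (\<lambda>x y. \<Sum>i\<le>n. c i * x ^ i * y ^ (n - i))"
    using homogeneous_polynomialE[OF assms] .
  show ?thesis
    unfolding h dx_polynomial dy_polynomial by (simp add: mult_ac)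
qed

text \<open>The rules for - h serve the second asymptotic field, which is obtained as the first
  field of - h.\<close>

lemma homogeneous_polynomial_minus:
  assumes "homogeneous_polynomial n h"
  shows "homogeneous_polynomial n (\<lambda>x y. - h x y)"
proof -
  obtain c where h: "h = (\<lambda>x y. \<Sum>i\<le>n. c i * x ^ i * y ^ (n - i))"
    using homogeneous_polynomialE[OF assms] .
  show ?thesis
    unfolding homogeneous_polynomial_def h
    by (rule exI[of _ "\<lambda>i. - c i"]) (simp add: sum_negf)
qed

lemma dx_minus:
  assumes "homogeneous_polynomial n h"
  shows "dx (\<lambda>x y. - h x y) = (\<lambda>x y. - dx h x y)"
proof -
  obtain c where h: "h = (\<lambda>x y. \<Sum>i\<le>n. c i * x ^ i * y ^ (n - i))"
    using homogeneous_polynomialE[OF assms] .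
  have "dx (\<lambda>x y. \<Sum>i\<le>n. - c i * x ^ i * y ^ (n - i)) =
      (\<lambda>x y. \<Sum>i\<le>n. (- c i * real i) * x ^ (i - 1) * y ^ (n - i))"
    by (rule dx_polynomial)
  moreover have "dx h = (\<lambda>x y. \<Sum>i\<le>n. (c i * real i) * x ^ (i - 1) * y ^ (n - i))"
    unfolding h by (rule dx_polynomial)
  ultimately show ?thesis
    by (simp add: h sum_negf)
qed

lemma dy_minus:
  assumes "homogeneous_polynomial n h"
  shows "dy (\<lambda>x y. - h x y) = (\<lambda>x y. - dy h x y)"
proof -
  obtain c where h: "h = (\<lambda>x y. \<Sum>i\<le>n. c i * x ^ i * y ^ (n - i))"
    using homogeneous_polynomialE[OF assms] .
  have "dy (\<lambda>x y. \<Sum>i\<le>n. - c i * x ^ i * y ^ (n - i)) =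
      (\<lambda>x y. \<Sum>i\<le>n. (- c i * real (n - i)) * x ^ i * y ^ (n - i - 1))"
    by (rule dy_polynomial)
  moreover have "dy h = (\<lambda>x y. \<Sum>i\<le>n. (c i * real (n - i)) * x ^ i * y ^ (n - i - 1))"
    unfolding h by (rule dy_polynomial)
  ultimately show ?thesis
    by (simp add: h sum_negf)
qed

section \<open>Scaling, Euler's identity and the chain rule\<close>

lemma homogeneous_polynomial_scale:
  assumes "homogeneous_polynomial n h"
  shows "h (t * x) (t * y) = t ^ n * h x y"
proof -
  obtain c where h: "h = (\<lambda>x y. \<Sum>i\<le>n. c i * x ^ i * y ^ (n - i))"
    using homogeneous_polynomialE[OF assms] .
  have "t ^ i * t ^ (n - i) = t ^ n" if "i \<le> n" for i
    using that by (simp flip: power_add)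
  then show ?thesis
    unfolding h sum_distrib_left
    by (intro sum.cong refl) (simp add: power_mult_distrib mult_ac)
qed

lemma euler_identity:
  assumes "homogeneous_polynomial n h"
  shows "x * dx h x y + y * dy h x y = real n * h x y"
proof -
  obtain c where h: "h = (\<lambda>x y. \<Sum>i\<le>n. c i * x ^ i * y ^ (n - i))"
    using homogeneous_polynomialE[OF assms] .
  have "x * (c i * real i * x ^ (i - 1) * y ^ (n - i)) +
      y * (c i * real (n - i) * x ^ i * y ^ (n - i - 1)) = real n * (c i * x ^ i * y ^ (n - i))"
    if "i \<le> n" for i
  proof -
    have 1: "x * (real i * x ^ (i - 1)) = real i * x ^ i"
      by (cases i) auto
    have 2: "y * (real (n - i) * y ^ (n - i - 1)) = real (n - i) * y ^ (n - i)"
      by (cases "n - i") auto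
    have "x * (c i * real i * x ^ (i - 1) * y ^ (n - i)) +
        y * (c i * real (n - i) * x ^ i * y ^ (n - i - 1)) =
        c i * y ^ (n - i) * (x * (real i * x ^ (i - 1))) +
        c i * x ^ i * (y * (real (n - i) * y ^ (n - i - 1)))"
      by (simp add: mult_ac)
    also have "\<dots> = (real i + real (n - i)) * (c i * x ^ i * y ^ (n - i))"
      unfolding 1 2 by (simp add: algebra_simps)
    also have "real i + real (n - i) = real n"
      using that by simp
    finally show ?thesis .
  qed
  then show ?thesis
    unfolding h dx_polynomial dy_polynomial sum_distrib_left sum.distrib[symmetric]
    by (intro sum.cong refl) simp
qed

lemma homogeneous_polynomial_chain_rule:
  assumes "homogeneous_polynomial n h"
    and "(u has_real_derivative u') (at t)" and "(v has_real_derivative v') (at t)"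
  shows "((\<lambda>s. h (u s) (v s)) has_real_derivative
    dx h (u t) (v t) * u' + dy h (u t) (v t) * v') (at t)"
proof -
  obtain c where h: "h = (\<lambda>x y. \<Sum>i\<le>n. c i * x ^ i * y ^ (n - i))"
    using homogeneous_polynomialE[OF assms(1)] .
  show ?thesis
    unfolding h dx_polynomial dy_polynomial sum_distrib_right sum.distrib[symmetric]
    by (rule assms(2,3) derivative_eq_intros refl)+ (simp add: algebra_simps)
qed

lemma continuous_on_homogeneous_polynomial:
  assumes "homogeneous_polynomial n h" "continuous_on S u" "continuous_on S v"
  shows "continuous_on S (\<lambda>s. h (u s) (v s))"
proof -
  obtain c where h: "h = (\<lambda>x y. \<Sum>i\<le>n. c i * x ^ i * y ^ (n - i))"
    using homogeneous_polynomialE[OF assms(1)] .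
  show ?thesis
    unfolding h using assms(2,3) by (intro continuous_intros)
qed

lemma homogeneous_polynomial_linear_mult:
  assumes "homogeneous_polynomial n h"
  shows "homogeneous_polynomial (Suc n) (\<lambda>x y. (a * x + b * y) * h x y)"
proof -
  obtain c where h: "h = (\<lambda>x y. \<Sum>i\<le>n. c i * x ^ i * y ^ (n - i))"
    using homogeneous_polynomialE[OF assms] .
  \<comment> \<open>Both ends are cut off explicitly: at 0 truncated subtraction would bring in
    \<open>c 0\<close>, and \<open>c (Suc n)\<close> is an arbitrary number.\<close>
  define d where "d i = (if i = 0 then 0 else a * c (i - 1)) + (if i = Suc n then 0 else b * c i)" for i
  have "(a * x + b * y) * h x y = (\<Sum>i\<le>Suc n. d i * x ^ i * y ^ (Suc n - i))" for x y
  proof -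
    have "(\<Sum>i\<le>Suc n. d i * x ^ i * y ^ (Suc n - i)) =
        (\<Sum>i\<le>Suc n. (if i = 0 then 0 else a * c (i - 1)) * x ^ i * y ^ (Suc n - i)) +
        (\<Sum>i\<le>Suc n. (if i = Suc n then 0 else b * c i) * x ^ i * y ^ (Suc n - i))"
      by (simp only: d_def distrib_right sum.distrib)
    also have "(\<Sum>i\<le>Suc n. (if i = 0 then 0 else a * c (i - 1)) * x ^ i * y ^ (Suc n - i)) =
        a * x * h x y"
      by (simp only: sum.atMost_Suc_shift) (simp add: h sum_distrib_left mult_ac)
    also have "(\<Sum>i\<le>Suc n. (if i = Suc n then 0 else b * c i) * x ^ i * y ^ (Suc n - i)) =
        b * y * h x y"
      by (simp add: h sum_distrib_left mult_ac Suc_diff_le)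
    finally show ?thesis
      by (simp add: algebra_simps)
  qed
  then show ?thesis
    unfolding homogeneous_polynomial_def by blast
qed

text \<open>Euler's identity for h, h_x and h_y eliminates all but one pure second derivative. What
  remains involves h on a single horizontal or vertical line, so hyperbolicity becomes an inequality
  in one variable.\<close>

lemma hessian_determinant_identities:
  assumes h: "homogeneous_polynomial n h" and "n \<ge> 2"
  shows "y\<^sup>2 * ((dy (dx h) x y)\<^sup>2 - dx (dx h) x y * dy (dy h) x y) =
    (real n - 1) * ((real n - 1) * (dx h x y)\<^sup>2 - real n * h x y * dx (dx h) x y)"
    and "x\<^sup>2 * ((dy (dx h) x y)\<^sup>2 - dx (dx h) x y * dy (dy h) x y) =
    (real n - 1) * ((real n - 1) * (dy h x y)\<^sup>2 - real n * h x y * dy (dy h) x y)"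
proof -
  obtain m where n: "n = Suc m" "real m = real n - 1"
    using \<open>n \<ge> 2\<close> by (cases n) auto
  have 0: "x * dx h x y + y * dy h x y = real n * h x y"
    by (rule euler_identity[OF h])
  have 1: "x * dx (dx h) x y + y * dy (dx h) x y = (real n - 1) * dx h x y"
    using euler_identity[OF homogeneous_polynomial_dx] h n by metis
  have 2: "x * dy (dx h) x y + y * dy (dy h) x y = (real n - 1) * dy h x y"
    using euler_identity[OF homogeneous_polynomial_dy] h n dx_dy_commute[OF h] by metis
  show "y\<^sup>2 * ((dy (dx h) x y)\<^sup>2 - dx (dx h) x y * dy (dy h) x y) =
    (real n - 1) * ((real n - 1) * (dx h x y)\<^sup>2 - real n * h x y * dx (dx h) x y)"
    using 0 1 2 by algebra
  show "x\<^sup>2 * ((dy (dx h) x y)\<^sup>2 - dx (dx h) x y * dy (dy h) x y) =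
    (real n - 1) * ((real n - 1) * (dy h x y)\<^sup>2 - real n * h x y * dy (dy h) x y)"
    using 0 1 2 by algebra
qed

section \<open>Products of distinct real linear forms are hyperbolic\<close>

text \<open>For n = 1 the expression vanishes identically, so the induction starts at 2, where it is
  the discriminant (a 1 * b 0 - a 0 * b 1)^2. Coefficients b i = 0 are allowed because the factor x
  is constant on vertical lines. The derivatives are existential so that the product rule can build
  them along the induction.\<close>

lemma product_of_linear_forms_derivatives:
  fixes a b :: "nat \<Rightarrow> real"
  assumes "n \<ge> 2" and "\<And>i j. i < j \<Longrightarrow> j < n \<Longrightarrow> a i * b j \<noteq> a j * b i"
  shows "\<exists>g' g''. (\<forall>s. ((\<lambda>s. \<Prod>i<n. a i + b i * s) has_real_derivative g' s) (at s)) \<and>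
    (\<forall>s. (g' has_real_derivative g'' s) (at s)) \<and>
    (\<forall>s. 0 < (real n - 1) * (g' s)\<^sup>2 - real n * (\<Prod>i<n. a i + b i * s) * g'' s)"
  using assms
proof (induction n rule: nat_induct_at_least)
  case base
  define l where "l i s = a i + b i * s" for i s
  have g: "(\<Prod>i<2. a i + b i * s) = l 0 s * l 1 s" for s
    by (simp add: numeral_2_eq_2 l_def)
  have 1: "((\<lambda>s. l 0 s * l 1 s) has_real_derivative (b 0 * l 1 s + l 0 s * b 1)) (at s)" for s
    unfolding l_def by (auto intro!: derivative_eq_intros simp: algebra_simps)
  have 2: "((\<lambda>s. b 0 * l 1 s + l 0 s * b 1) has_real_derivative 2 * b 0 * b 1) (at s)" for s
    unfolding l_def by (auto intro!: derivative_eq_intros simp: algebra_simps)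
  have 3: "0 < (real 2 - 1) * (b 0 * l 1 s + l 0 s * b 1)\<^sup>2 -
      real 2 * (l 0 s * l 1 s) * (2 * b 0 * b 1)" for s
  proof -
    have "a 0 * b 1 \<noteq> a 1 * b 0"
      using base by auto
    then have "b 0 * l 1 s - l 0 s * b 1 \<noteq> 0"
      by (simp add: l_def algebra_simps)
    then have "0 < (b 0 * l 1 s - l 0 s * b 1)\<^sup>2"
      by simp
    also have "\<dots> = (real 2 - 1) * (b 0 * l 1 s + l 0 s * b 1)\<^sup>2 -
        real 2 * (l 0 s * l 1 s) * (2 * b 0 * b 1)"
      by (simp add: power2_eq_square algebra_simps)
    finally show ?thesis .
  qed
  show ?case
    unfolding g
    by (rule exI[of _ "\<lambda>s. b 0 * l 1 s + l 0 s * b 1"], rule exI[of _ "\<lambda>s. 2 * b 0 * b 1"])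
      (intro conjI allI 1 2 3)
next
  case (Suc n)
  define g where "g = (\<lambda>s. \<Prod>i<n. a i + b i * s)"
  define l where "l s = a n + b n * s" for s
  have "\<exists>g' g''. (\<forall>s. (g has_real_derivative g' s) (at s)) \<and>
      (\<forall>s. (g' has_real_derivative g'' s) (at s)) \<and>
      (\<forall>s. 0 < (real n - 1) * (g' s)\<^sup>2 - real n * g s * g'' s)"
    unfolding g_def using Suc.prems by (intro Suc.IH) simp
  then obtain g' g'' where g': "\<And>s. (g has_real_derivative g' s) (at s)"
    and g'': "\<And>s. (g' has_real_derivative g'' s) (at s)"
    and pos: "\<And>s. 0 < (real n - 1) * (g' s)\<^sup>2 - real n * g s * g'' s"
    by blast
  have l': "(l has_real_derivative b n) (at s)" for s
    unfolding l_def by (auto intro!: derivative_eq_intros)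
  have g_Suc: "(\<Prod>i<Suc n. a i + b i * s) = g s * l s" for s
    by (simp add: g_def l_def)
  have 1: "((\<lambda>s. g s * l s) has_real_derivative (g' s * l s + g s * b n)) (at s)" for s
    using g' l' by (auto intro!: derivative_eq_intros)
  have 2: "((\<lambda>s. g' s * l s + g s * b n) has_real_derivative (g'' s * l s + 2 * g' s * b n)) (at s)" for s
    using g' g'' l' by (auto intro!: derivative_eq_intros)
  have 3: "0 < (real (Suc n) - 1) * (g' s * l s + g s * b n)\<^sup>2 -
      real (Suc n) * (g s * l s) * (g'' s * l s + 2 * g' s * b n)" (is "0 < ?W") for s
  proof -
    have n: "real n > 0"
      using Suc.hyps by simp
    \<comment> \<open>Completing the square: multiplied by n, the new expression is (n+1) l^2 times
      the old one plus a square.\<close>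
    have W: "real n * ?W = (real n + 1) * (l s)\<^sup>2 * ((real n - 1) * (g' s)\<^sup>2 - real n * g s * g'' s) +
        (l s * g' s - real n * g s * b n)\<^sup>2"
      by (simp add: power2_eq_square algebra_simps)
    have "0 < real n * ?W"
    proof (cases "l s = 0")
      case True
      \<comment> \<open>At a root of the new factor only the square (n g b_n)^2 survives;
        independence of the forms gives b_n and g nonzero there.\<close>
      have ind: "a i * b n \<noteq> a n * b i" if "i < n" for i
        using Suc.prems that by simp
      have an: "a n = - b n * s"
        using True by (simp add: l_def)
      have "b n \<noteq> 0"
        using ind[of 0] an Suc.hyps by auto
      moreover have "a i + b i * s \<noteq> 0" if "i < n" for i
        using ind[OF that] unfolding an by (auto simp: add_eq_0_iff2)
      then have "g s \<noteq> 0"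
        by (simp add: g_def)
      ultimately show ?thesis
        using n True unfolding W by simp
    next
      case False
      then show ?thesis
        unfolding W using pos[of s] n by (intro add_pos_nonneg mult_pos_pos) auto
    qed
    then show ?thesis
      using n by (simp add: zero_less_mult_iff)
  qed
  show ?case
    unfolding g_Suc
    by (rule exI[of _ "\<lambda>s. g' s * l s + g s * b n"],
        rule exI[of _ "\<lambda>s. g'' s * l s + 2 * g' s * b n"])
      (intro conjI allI 1 2 3)
qed

lemma homogeneous_polynomial_product:
  "homogeneous_polynomial n (\<lambda>x y. \<Prod>i<n. x - c i * y)"
proof (induction n)
  case 0
  show ?case
    unfolding homogeneous_polynomial_def by (intro exI[of _ "\<lambda>_. 1"]) simp
next
  case (Suc n)
  show ?case
    using homogeneous_polynomial_linear_mult[OF Suc.IH, of 1 "- c n"] by (simp add: mult.commute)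
qed

lemma hyperbolic_product:
  fixes c :: "nat \<Rightarrow> real"
  assumes "n \<ge> 2" and "inj_on c {..<n}"
  shows "hyperbolic_polynomial (\<lambda>x y. \<Prod>i<n. x - c i * y)"
proof -
  define h where "h = (\<lambda>x y. \<Prod>i<n. x - c i * y)"
  have h: "homogeneous_polynomial n h"
    unfolding h_def by (rule homogeneous_polynomial_product)
  have "dx (dx h) x y * dy (dy h) x y - (dy (dx h) x y)\<^sup>2 < 0" if "(x, y) \<noteq> (0, 0)" for x y
  proof -
    have deriv: "deriv g = g'" if "\<And>s. (g has_real_derivative g' s) (at s)"
      for g g' :: "real \<Rightarrow> real"
      using that by (auto intro!: DERIV_imp_deriv)
    have cne: "c i \<noteq> c j" if "i < j" "j < n" for i j
      using that inj_onD[OF assms(2), of i j] by auto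
    have "0 < (dy (dx h) x y)\<^sup>2 - dx (dx h) x y * dy (dy h) x y"
    \<comment> \<open>The first identity, on the horizontal line through the point, gives the sign
      only after division by y^2. Points of the x-axis are therefore treated on the vertical line,
      with the second identity.\<close>
    proof (cases "y = 0")
      case False
      have "- c i * y * 1 \<noteq> - c j * y * 1" if "i < j" "j < n" for i j
        using cne[OF that] False by simp
      then obtain g' g'' where g:
        "\<And>s. ((\<lambda>s. \<Prod>i<n. - c i * y + 1 * s) has_real_derivative g' s) (at s)"
        "\<And>s. (g' has_real_derivative g'' s) (at s)"
        "\<And>s. 0 < (real n - 1) * (g' s)\<^sup>2 - real n * (\<Prod>i<n. - c i * y + 1 * s) * g'' s"
        using product_of_linear_forms_derivatives[OF assms(1), of "\<lambda>i. - c i * y" "\<lambda>_. 1"] by blast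
      have hs: "(\<lambda>s. h s y) = (\<lambda>s. \<Prod>i<n. - c i * y + 1 * s)"
        by (simp add: h_def)
      have "0 < (real n - 1) * (dx h x y)\<^sup>2 - real n * h x y * dx (dx h) x y"
        using g(3)[of x] deriv[OF g(1)] deriv[OF g(2)] unfolding dx_def hs[symmetric]
        by (simp add: h_def)
      then have "0 < (real n - 1) * ((real n - 1) * (dx h x y)\<^sup>2 - real n * h x y * dx (dx h) x y)"
        using assms(1) by (intro mult_pos_pos) auto
      then show ?thesis
        unfolding hessian_determinant_identities(1)[OF h assms(1), symmetric] using False
        by (simp add: zero_less_mult_iff)
    next
      case True
      with that have x: "x \<noteq> 0"
        by simp
      have "x * - c j \<noteq> x * - c i" if "i < j" "j < n" for i j
        using cne[OF that] x by simp
      then obtain g' g'' where g: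
        "\<And>s. ((\<lambda>s. \<Prod>i<n. x + - c i * s) has_real_derivative g' s) (at s)"
        "\<And>s. (g' has_real_derivative g'' s) (at s)"
        "\<And>s. 0 < (real n - 1) * (g' s)\<^sup>2 - real n * (\<Prod>i<n. x + - c i * s) * g'' s"
        using product_of_linear_forms_derivatives[OF assms(1), of "\<lambda>_. x" "\<lambda>i. - c i"] by blast
      have hs: "h x = (\<lambda>s. \<Prod>i<n. x + - c i * s)"
        by (simp add: h_def)
      have "0 < (real n - 1) * (dy h x y)\<^sup>2 - real n * h x y * dy (dy h) x y"
        using g(3)[of y] deriv[OF g(1)] deriv[OF g(2)] unfolding dy_def hs[symmetric]
        by (simp add: h_def)
      then have "0 < (real n - 1) * ((real n - 1) * (dy h x y)\<^sup>2 - real n * h x y * dy (dy h) x y)"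
        using assms(1) by (intro mult_pos_pos) auto
      then show ?thesis
        unfolding hessian_determinant_identities(2)[OF h assms(1), symmetric] using x
        by (simp add: zero_less_mult_iff)
    qed
    then show ?thesis
      by simp
  qed
  then show ?thesis
    using assms(1) h unfolding hyperbolic_polynomial_def h_def[symmetric] by auto
qed

section \<open>The asymptotic fields as eigenline fields\<close>

definition hessian_discriminant :: "(real \<Rightarrow> real \<Rightarrow> real) \<Rightarrow> real \<Rightarrow> real \<Rightarrow> real" where
  "hessian_discriminant h x y = (dy (dx h) x y)\<^sup>2 - dx (dx h) x y * dy (dy h) x y"

text \<open>With the Hessian matrix \<open>B\<close>, its discriminant \<open>D = - det B\<close> and the rotation \<open>J\<close> by a right
  angle, this is the kernel of \<open>B - \<surd>D J\<close>. For \<open>- h\<close> in place of \<open>h\<close> it is the kernel of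
  \<open>B + \<surd>D J\<close>.\<close>

definition asymptotic_field :: "(real \<Rightarrow> real \<Rightarrow> real) \<Rightarrow> line_field" where
  "asymptotic_field h = (\<lambda>(x, y).
     {(a, b). dx (dx h) x y * a + (dy (dx h) x y + sqrt (hessian_discriminant h x y)) * b = 0 \<and>
              (dy (dx h) x y - sqrt (hessian_discriminant h x y)) * a + dy (dy h) x y * b = 0})"

text \<open>The determinant is 0, so either row determines the line unless it vanishes; the
  generators are the two rows turned by a right angle. Both are needed: each can vanish somewhere,
  but for r > 0 never at the same point.\<close>

lemma null_line_eq_span:
  fixes P Q S r :: real
  assumes r: "r\<^sup>2 = Q\<^sup>2 - P * S"
  defines "L \<equiv> {(a, b). P * a + (Q + r) * b = 0 \<and> (Q - r) * a + S * b = 0}"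
  shows "(- (Q + r), P) \<noteq> 0 \<Longrightarrow> L = span {(- (Q + r), P)}"
    and "(S, r - Q) \<noteq> 0 \<Longrightarrow> L = span {(S, r - Q)}"
proof -
  have PS: "P * S = (Q + r) * (Q - r)"
    using r by (simp add: algebra_simps power2_eq_square)
  show "L = span {(- (Q + r), P)}" if nz: "(- (Q + r), P) \<noteq> 0"
  proof (intro equalityI subsetI)
    fix v assume "v \<in> span {(- (Q + r), P)}"
    then obtain t where v: "v = (t * - (Q + r), t * P)"
      by (auto simp: span_singleton)
    have "P * (t * - (Q + r)) + (Q + r) * (t * P) = 0"
      by (simp add: algebra_simps)
    moreover have "(Q - r) * (t * - (Q + r)) + S * (t * P) = 0"
      using PS by algebra
    ultimately show "v \<in> L"
      by (simp add: v L_def)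
  next
    fix v assume "v \<in> L"
    then obtain a b where v: "v = (a, b)" "P * a + (Q + r) * b = 0" "(Q - r) * a + S * b = 0"
      by (auto simp: L_def)
    show "v \<in> span {(- (Q + r), P)}"
    proof (cases "P = 0")
      case True
      with nz v have "v = (- a / (Q + r)) *\<^sub>R (- (Q + r), P)"
        by (auto simp: zero_prod_def)
      then show ?thesis
        unfolding span_singleton by blast
    next
      case False
      with v have "v = (b / P) *\<^sub>R (- (Q + r), P)"
        by (auto simp: field_simps add_eq_0_iff2)
      then show ?thesis
        unfolding span_singleton by blast
    qed
  qed
  show "L = span {(S, r - Q)}" if nz: "(S, r - Q) \<noteq> 0"
  proof (intro equalityI subsetI)
    fix v assume "v \<in> span {(S, r - Q)}"
    then obtain t where v: "v = (t * S, t * (r - Q))"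
      by (auto simp: span_singleton)
    have "P * (t * S) + (Q + r) * (t * (r - Q)) = 0"
      using PS by algebra
    moreover have "(Q - r) * (t * S) + S * (t * (r - Q)) = 0"
      by (simp add: algebra_simps)
    ultimately show "v \<in> L"
      by (simp add: v L_def)
  next
    fix v assume "v \<in> L"
    then obtain a b where v: "v = (a, b)" "P * a + (Q + r) * b = 0" "(Q - r) * a + S * b = 0"
      by (auto simp: L_def)
    show "v \<in> span {(S, r - Q)}"
    proof (cases "S = 0")
      case True
      with nz v have "v = (b / (r - Q)) *\<^sub>R (S, r - Q)"
        by (auto simp: zero_prod_def)
      then show ?thesis
        unfolding span_singleton by blast
    next
      case False
      with v have "v = (a / S) *\<^sub>R (S, r - Q)"
        by (auto simp: field_simps add_eq_0_iff2)
      then show ?thesis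
        unfolding span_singleton by blast
    qed
  qed
qed

lemma hyperbolic_polynomial_homogeneous:
  assumes "hyperbolic_polynomial h"
  shows "\<exists>m. homogeneous_polynomial (Suc (Suc m)) h"
proof -
  obtain n where n: "n \<ge> 2" "homogeneous_polynomial n h"
    using assms unfolding hyperbolic_polynomial_def by blast
  then have "n = Suc (Suc (n - 2))"
    by simp
  then show ?thesis
    using n(2) by metis
qed

lemma hessian_discriminant_pos:
  assumes "hyperbolic_polynomial h" and "(x, y) \<noteq> (0, 0)"
  shows "0 < hessian_discriminant h x y"
  using assms unfolding hyperbolic_polynomial_def hessian_discriminant_def by auto

lemma second_derivatives_minus:
  assumes "homogeneous_polynomial (Suc (Suc m)) h"
  shows "dx (dx (\<lambda>x y. - h x y)) = (\<lambda>x y. - dx (dx h) x y)" (is ?xx)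
    and "dy (dx (\<lambda>x y. - h x y)) = (\<lambda>x y. - dy (dx h) x y)" (is ?xy)
    and "dy (dy (\<lambda>x y. - h x y)) = (\<lambda>x y. - dy (dy h) x y)" (is ?yy)
    and "hessian_discriminant (\<lambda>x y. - h x y) = hessian_discriminant h"
proof -
  note dh = homogeneous_polynomial_dx[OF assms] homogeneous_polynomial_dy[OF assms]
  show xx: ?xx and xy: ?xy and yy: ?yy
    unfolding dx_minus[OF assms] dy_minus[OF assms]
    by (rule dx_minus[OF dh(1)] dy_minus[OF dh(1)] dy_minus[OF dh(2)])+
  show "hessian_discriminant (\<lambda>x y. - h x y) = hessian_discriminant h"
    unfolding hessian_discriminant_def xx xy yy by simp
qed

lemma hyperbolic_polynomial_minus:
  assumes "hyperbolic_polynomial h"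
  shows "hyperbolic_polynomial (\<lambda>x y. - h x y)"
proof -
  obtain m where m: "homogeneous_polynomial (Suc (Suc m)) h"
    using hyperbolic_polynomial_homogeneous[OF assms] by blast
  show ?thesis
    unfolding hyperbolic_polynomial_def second_derivatives_minus[OF m]
    using homogeneous_polynomial_minus[OF m] hessian_discriminant_pos[OF assms]
    by (auto simp: hessian_discriminant_def intro!: exI[of _ "Suc (Suc m)"])
qed

lemma continuous_line_field_asymptotic_field:
  assumes "hyperbolic_polynomial h"
  shows "continuous_line_field_on (- {0}) (asymptotic_field h)"
  unfolding continuous_line_field_on_def
proof
  fix p :: "real \<times> real"
  assume "p \<in> - {0}"
  obtain m where m: "homogeneous_polynomial (Suc (Suc m)) h"
    using hyperbolic_polynomial_homogeneous[OF assms] by blast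
  note pos = hessian_discriminant_pos[OF assms]
  define P Q S r where "P q = dx (dx h) (fst q) (snd q)" and "Q q = dy (dx h) (fst q) (snd q)"
    and "S q = dy (dy h) (fst q) (snd q)" and "r q = sqrt (hessian_discriminant h (fst q) (snd q))"
  for q
  have cont: "continuous_on UNIV P" "continuous_on UNIV Q" "continuous_on UNIV S"
    unfolding P_def Q_def S_def
    by (rule continuous_on_homogeneous_polynomial homogeneous_polynomial_dx
        homogeneous_polynomial_dy m continuous_intros)+
  then have contr: "continuous_on UNIV r"
    unfolding r_def hessian_discriminant_def P_def Q_def S_def by (intro continuous_intros)
  have r: "r q > 0" "(r q)\<^sup>2 = (Q q)\<^sup>2 - P q * S q" if "q \<noteq> 0" for q
    using pos[of "fst q" "snd q"] that
    by (auto simp: r_def hessian_discriminant_def P_def Q_def S_def zero_prod_def prod_eq_iff)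
  have L: "asymptotic_field h q =
      {(a, b). P q * a + (Q q + r q) * b = 0 \<and> (Q q - r q) * a + S q * b = 0}" for q
    by (simp add: asymptotic_field_def P_def Q_def S_def r_def case_prod_unfold)
  \<comment> \<open>A global continuous X suffices: the neighbourhood U is the open set where it
    does not vanish.\<close>
  have claim: "\<exists>U X. open U \<and> p \<in> U \<and> continuous_on (U \<inter> - {0}) X \<and>
        (\<forall>q\<in>U \<inter> - {0}. X q \<noteq> 0 \<and> asymptotic_field h q = span {X q})"
    if "continuous_on UNIV X" "X p \<noteq> 0"
      "\<And>q. q \<noteq> 0 \<Longrightarrow> X q \<noteq> 0 \<Longrightarrow> asymptotic_field h q = span {X q}"
    for X :: "real \<times> real \<Rightarrow> real \<times> real"
  proof (intro exI conjI)
    show "open (X -` (- {0}))"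
      using that(1) by (intro open_vimage) auto
    show "continuous_on (X -` (- {0}) \<inter> - {0}) X"
      using that(1) continuous_on_subset by blast
  qed (use that in auto)
  show "\<exists>U X. open U \<and> p \<in> U \<and> continuous_on (U \<inter> - {0}) X \<and>
        (\<forall>q\<in>U \<inter> - {0}. X q \<noteq> 0 \<and> asymptotic_field h q = span {X q})"
  proof (cases "(- (Q p + r p), P p) = 0")
    case False
    then show ?thesis
      using cont contr null_line_eq_span(1)[OF r(2)]
      by (intro claim[of "\<lambda>q. (- (Q q + r q), P q)"]) (auto simp: L intro!: continuous_intros)
  next
    case True
    \<comment> \<open>The first generator vanishes only where Q = - r, and there r - Q = 2 r is
      positive.\<close>
    then have "r p - Q p \<noteq> 0"
      using r(1)[of p] \<open>p \<in> - {0}\<close> by (auto simp: zero_prod_def)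
    then show ?thesis
      using cont contr null_line_eq_span(2)[OF r(2)]
      by (intro claim[of "\<lambda>q. (S q, r q - Q q)"])
        (auto simp: L zero_prod_def intro!: continuous_intros)
  qed
qed

lemma asymptotic_fields_asymptotic_field:
  assumes "hyperbolic_polynomial h"
  shows "asymptotic_fields h (asymptotic_field h) (asymptotic_field (\<lambda>x y. - h x y))"
proof -
  obtain m where m: "homogeneous_polynomial (Suc (Suc m)) h"
    using hyperbolic_polynomial_homogeneous[OF assms] by blast
  note pos = hessian_discriminant_pos[OF assms]
  have "asymptotic_field h (x, y) \<noteq> asymptotic_field (\<lambda>x y. - h x y) (x, y) \<and>
      {v. second_form h (x, y) v = 0} =
        asymptotic_field h (x, y) \<union> asymptotic_field (\<lambda>x y. - h x y) (x, y)"
    if xy: "(x, y) \<noteq> (0, 0)" for x y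
  proof
    define P Q S r where "P = dx (dx h) x y" and "Q = dy (dx h) x y"
      and "S = dy (dy h) x y" and "r = sqrt (hessian_discriminant h x y)"
    have r: "r > 0" "r\<^sup>2 = Q\<^sup>2 - P * S"
      using pos[OF xy] by (auto simp: r_def hessian_discriminant_def P_def Q_def S_def)
    have PS: "P * S = (Q + r) * (Q - r)"
      using r by (simp add: algebra_simps power2_eq_square)
    have L1: "(a, b) \<in> asymptotic_field h (x, y) \<longleftrightarrow>
        P * a + (Q + r) * b = 0 \<and> (Q - r) * a + S * b = 0" for a b
      by (simp add: asymptotic_field_def P_def Q_def S_def r_def)
    have L2: "(a, b) \<in> asymptotic_field (\<lambda>x y. - h x y) (x, y) \<longleftrightarrow>
        P * a + (Q - r) * b = 0 \<and> (Q + r) * a + S * b = 0" for a b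
      unfolding asymptotic_field_def second_derivatives_minus[OF m]
      by (auto simp: P_def Q_def S_def r_def algebra_simps)
    show "asymptotic_field h (x, y) \<noteq> asymptotic_field (\<lambda>x y. - h x y) (x, y)"
    proof
      assume eq: "asymptotic_field h (x, y) = asymptotic_field (\<lambda>x y. - h x y) (x, y)"
      \<comment> \<open>Subtracting the equations of the two lines shows that a common vector is 0;
        the line itself is not trivial, because the two generators below do not vanish
        together.\<close>
      have "a = 0 \<and> b = 0" if "(a, b) \<in> asymptotic_field h (x, y)" for a b
      proof -
        have "2 * r * a = ((Q + r) * a + S * b) - ((Q - r) * a + S * b)"
          "2 * r * b = (P * a + (Q + r) * b) - (P * a + (Q - r) * b)"
          by (simp_all add: algebra_simps)
        then have "2 * r * a = 0" "2 * r * b = 0"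
          using that that[unfolded eq] unfolding L1 L2 by simp_all
        then show ?thesis
          using r(1) by simp
      qed
      moreover have "(- (Q + r), P) \<in> asymptotic_field h (x, y)"
        "(S, r - Q) \<in> asymptotic_field h (x, y)"
        unfolding L1 using PS by (auto simp: algebra_simps)
      ultimately have "- (Q + r) = 0" "r - Q = 0"
        by blast+
      then show False
        using r(1) by simp
    qed
    have *: "P * a\<^sup>2 + 2 * Q * a * b + S * b\<^sup>2 = 0 \<longleftrightarrow>
        P * a + (Q + r) * b = 0 \<and> (Q - r) * a + S * b = 0 \<or>
        P * a + (Q - r) * b = 0 \<and> (Q + r) * a + S * b = 0" (is "?l \<longleftrightarrow> ?r") for a b
    proof
      assume ?r
      then show ?l
      proof
        assume "P * a + (Q + r) * b = 0 \<and> (Q - r) * a + S * b = 0"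
        then have "a * (P * a + (Q + r) * b) + b * ((Q - r) * a + S * b) = 0"
          by simp
        then show ?l
          by (simp add: algebra_simps power2_eq_square)
      next
        assume "P * a + (Q - r) * b = 0 \<and> (Q + r) * a + S * b = 0"
        then have "a * (P * a + (Q - r) * b) + b * ((Q + r) * a + S * b) = 0"
          by simp
        then show ?l
          by (simp add: algebra_simps power2_eq_square)
      qed
    next
      assume l: ?l
      \<comment> \<open>Each equation of one line times each equation of the other is a multiple of
        the quadratic form, with the factors P, S, Q + r and Q - r. So if one equation of the first
        line fails, both equations of the second hold.\<close>
      have 1: "(P * a + (Q + r) * b) * (P * a + (Q - r) * b) = 0"
        using l PS by algebra
      have 2: "((Q - r) * a + S * b) * ((Q + r) * a + S * b) = 0"
        using l PS by algebra
      have 3: "(P * a + (Q + r) * b) * ((Q + r) * a + S * b) = 0"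
        using l PS by algebra
      have 4: "((Q - r) * a + S * b) * (P * a + (Q - r) * b) = 0"
        using l PS by algebra
      show ?r
        using 1 2 3 4 by (auto simp del: mult_eq_0_iff simp: mult_eq_0_iff[of "_ + _" "_ + _"])
    qed
    show "{v. second_form h (x, y) v = 0} =
        asymptotic_field h (x, y) \<union> asymptotic_field (\<lambda>x y. - h x y) (x, y)"
    proof (intro set_eqI)
      fix v :: "real \<times> real"
      obtain a b where v: "v = (a, b)"
        by (cases v)
      have "v \<in> {v. second_form h (x, y) v = 0} \<longleftrightarrow> P * a\<^sup>2 + 2 * Q * a * b + S * b\<^sup>2 = 0"
        by (simp add: v second_form_def P_def Q_def S_def)
      also note *
      finally show "v \<in> {v. second_form h (x, y) v = 0} \<longleftrightarrow>
          v \<in> asymptotic_field h (x, y) \<union> asymptotic_field (\<lambda>x y. - h x y) (x, y)"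
        unfolding v Un_iff L1 L2 .
    qed
  qed
  then show ?thesis
    unfolding asymptotic_fields_def
    using continuous_line_field_asymptotic_field hyperbolic_polynomial_minus assms
    by (auto simp: zero_prod_def)
qed

text \<open>All second derivatives and the root of the discriminant scale by t^m. For t < 0 and odd
  m the root would change its sign relative to the Hessian and the two fields would be exchanged.
  The factor k serves to rescale tangent vectors of curves.\<close>

lemma asymptotic_field_scale:
  assumes "homogeneous_polynomial (Suc (Suc m)) h" and "t > 0" and "v \<in> asymptotic_field h (x, y)"
  shows "k *\<^sub>R v \<in> asymptotic_field h (t * x, t * y)"
proof -
  note dh = homogeneous_polynomial_dx[OF assms(1)] homogeneous_polynomial_dy[OF assms(1)]
  note ddh = homogeneous_polynomial_dx[OF dh(1)] homogeneous_polynomial_dy[OF dh(1)]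
    homogeneous_polynomial_dy[OF dh(2)]
  note scale = ddh[THEN homogeneous_polynomial_scale, of t x y]
  have "hessian_discriminant h (t * x) (t * y) = (t ^ m)\<^sup>2 * hessian_discriminant h x y"
    unfolding hessian_discriminant_def scale by (simp add: power2_eq_square algebra_simps)
  then have sqrt: "sqrt (hessian_discriminant h (t * x) (t * y)) = t ^ m * sqrt (hessian_discriminant h x y)"
    using assms(2) by (simp add: real_sqrt_mult)
  define P Q S r where "P = dx (dx h) x y" and "Q = dy (dx h) x y"
    and "S = dy (dy h) x y" and "r = sqrt (hessian_discriminant h x y)"
  obtain a b where v: "v = (a, b)"
    by (cases v)
  have "P * a + (Q + r) * b = 0" "(Q - r) * a + S * b = 0"
    using assms(3) by (auto simp: v asymptotic_field_def P_def Q_def S_def r_def)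
  moreover have "(t ^ m * P) * (k * a) + (t ^ m * Q + t ^ m * r) * (k * b) =
      (t ^ m * k) * (P * a + (Q + r) * b)"
    "(t ^ m * Q - t ^ m * r) * (k * a) + (t ^ m * S) * (k * b) =
      (t ^ m * k) * ((Q - r) * a + S * b)"
    by (simp_all add: algebra_simps)
  ultimately show ?thesis
    by (simp add: v asymptotic_field_def scale sqrt P_def Q_def S_def r_def)
qed

text \<open>At a zero p of h the gradient is angular, grad h = \<mu> Jp, where \<mu> is the
  derivative of h along the circle. Euler's identity for the first derivatives gives Bp = (n-1)
  \<mu> Jp, so the sign of \<mu> tells which of the two eigenlines is radial.\<close>

lemma radial_asymptotic_direction:
  assumes "hyperbolic_polynomial h" and "x\<^sup>2 + y\<^sup>2 = 1" and "h x y = 0"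
    and "0 \<le> x * dy h x y - y * dx h x y"
  shows "(x, y) \<in> asymptotic_field h (x, y)"
proof -
  obtain m where m: "homogeneous_polynomial (Suc (Suc m)) h"
    using hyperbolic_polynomial_homogeneous[OF assms(1)] by blast
  define \<mu> where "\<mu> = x * dy h x y - y * dx h x y"
  have "x * dx h x y + y * dy h x y = 0"
    using euler_identity[OF m] assms(3) by simp
  then have hx: "dx h x y = - \<mu> * y" and hy: "dy h x y = \<mu> * x"
    using assms(2) unfolding \<mu>_def by algebra+
  have 1: "x * dx (dx h) x y + y * dy (dx h) x y = (real m + 1) * (- \<mu> * y)"
    using euler_identity[OF homogeneous_polynomial_dx[OF m]] hx by simp
  have 2: "x * dy (dx h) x y + y * dy (dy h) x y = (real m + 1) * (\<mu> * x)"
    using euler_identity[OF homogeneous_polynomial_dy[OF m]] hy dx_dy_commute[OF m] by simp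
  have "hessian_discriminant h x y = ((real m + 1) * \<mu>)\<^sup>2"
    unfolding hessian_discriminant_def using 1 2 assms(2) by algebra
  then have r: "sqrt (hessian_discriminant h x y) = (real m + 1) * \<mu>"
    using assms(4) by (simp add: \<mu>_def)
  define P Q S where "P = dx (dx h) x y" and "Q = dy (dx h) x y" and "S = dy (dy h) x y"
  have "P * x + (Q + (real m + 1) * \<mu>) * y = 0" "(Q - (real m + 1) * \<mu>) * x + S * y = 0"
    using 1 2 unfolding P_def Q_def S_def by algebra+
  then show ?thesis
    by (simp add: asymptotic_field_def r P_def Q_def S_def)
qed

section \<open>Leaves in polar coordinates\<close>

text \<open>In the frame of the radial direction \<open>(x, y)\<close> and the angular direction \<open>(- y, x)\<close> the
  Hessian has the entries \<open>P\<close>, \<open>A\<close>, \<open>C\<close>, and \<open>s\<close> is the slope dr/d\<open>\<theta>\<close> of the null direction on the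
  unit circle. The quotients \<open>- (A + r) / P\<close> and \<open>C / (r - A)\<close> both represent \<open>s\<close>; this weighted
  mean of the two is defined wherever one of them is.\<close>

lemma slope_asymptotic_direction:
  fixes x y :: real
  assumes "x\<^sup>2 + y\<^sup>2 = 1" and r: "r\<^sup>2 = hxy\<^sup>2 - hxx * hyy"
    and P: "P = hxx * x\<^sup>2 + 2 * hxy * x * y + hyy * y\<^sup>2"
    and A: "A = hxy * (x\<^sup>2 - y\<^sup>2) + (hyy - hxx) * x * y"
    and C: "C = hxx * y\<^sup>2 - 2 * hxy * x * y + hyy * x\<^sup>2"
    and nz: "P\<^sup>2 + (r - A)\<^sup>2 \<noteq> 0"
    and s: "s = (C * (r - A) - (A + r) * P) / (P\<^sup>2 + (r - A)\<^sup>2)"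
  shows "s * P + A = - r"
    and "hxx * (s * x - y) + (hxy + r) * (s * y + x) = 0"
    and "(hxy - r) * (s * x - y) + hyy * (s * y + x) = 0"
proof -
  \<comment> \<open>The determinant of the Hessian is the same in the rotated orthonormal
    frame.\<close>
  have PC: "P * C = A\<^sup>2 - r\<^sup>2"
    using assms(1) r unfolding P A C by algebra
  have 0: "s * (P\<^sup>2 + (r - A)\<^sup>2) = C * (r - A) - (A + r) * P"
    using nz unfolding s by simp
  have "(s * P + (A + r)) * (P\<^sup>2 + (r - A)\<^sup>2) = 0"
    using 0 PC by algebra
  then have "s * P + (A + r) = 0"
    using nz by (simp only: mult_eq_0_iff simp_thms)
  then show 1: "s * P + A = - r"
    by simp
  have "(s * (r - A) - C) * (P\<^sup>2 + (r - A)\<^sup>2) = 0"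
    using 0 PC by algebra
  then have "s * (r - A) - C = 0"
    using nz by (simp only: mult_eq_0_iff simp_thms)
  then have 2: "s * (r - A) = C"
    by simp
  \<comment> \<open>In the rotated frame, B - rJ applied to (s, 1) has the components s P + A + r
    and C - s (r - A), which were just shown to vanish.\<close>
  show "hxx * (s * x - y) + (hxy + r) * (s * y + x) = 0"
    using assms(1) 1 2 unfolding P A C by algebra
  show "(hxy - r) * (s * x - y) + hyy * (s * y + x) = 0"
    using assms(1) 1 2 unfolding P A C by algebra
qed

lemma homogeneous_polynomial_polar_derivative:
  assumes "homogeneous_polynomial n h"
  shows "((\<lambda>\<theta>. h (cos \<theta>) (sin \<theta>)) has_real_derivative
    cos \<theta> * dy h (cos \<theta>) (sin \<theta>) - sin \<theta> * dx h (cos \<theta>) (sin \<theta>)) (at \<theta>)"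
  by (rule DERIV_cong[OF homogeneous_polynomial_chain_rule[OF assms]])
    (auto intro!: derivative_eq_intros)

lemma derivative_nonneg_right:
  fixes F :: "real \<Rightarrow> real"
  assumes "(F has_real_derivative D) (at a)" and "a < b" and "\<forall>x\<in>{a<..<b}. F a \<le> F x"
  shows "0 \<le> D"
proof (rule ccontr)
  assume "\<not> 0 \<le> D"
  then obtain d where d: "d > 0" "\<And>t. 0 < t \<Longrightarrow> t < d \<Longrightarrow> F (a + t) < F a"
    using DERIV_neg_dec_right[OF assms(1)] by (auto simp: not_le)
  define t where "t = min d (b - a) / 2"
  have "0 < t" "t < d" "a + t < b"
    using d(1) \<open>a < b\<close> by (auto simp: t_def min_def field_simps)
  then show False
    using d(2)[of t] assms(3)[rule_format, of "a + t"] by simp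
qed

text \<open>At a and c the radial direction belongs to this field, at b to the other one. The
  function s is the logarithmic slope of the leaf. The last clause is unboundedness towards both
  ends, in the form needed to reach every circle.\<close>

lemma polar_leaf:
  fixes a b c :: real
  assumes "hyperbolic_polynomial h" and "a < b" "b < c"
    and zero: "h (cos a) (sin a) = 0" "h (cos b) (sin b) = 0" "h (cos c) (sin c) = 0"
    and signs: "\<forall>\<theta>\<in>{a<..<b}. 0 < h (cos \<theta>) (sin \<theta>)" "\<forall>\<theta>\<in>{b<..<c}. h (cos \<theta>) (sin \<theta>) < 0"
  shows "\<exists>\<rho> s :: real \<Rightarrow> real. \<forall>\<theta>\<in>{a<..<c}. 0 < \<rho> \<theta> \<and>
    (\<rho> has_real_derivative \<rho> \<theta> * s \<theta>) (at \<theta>) \<and> isCont s \<theta> \<and>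
    (s \<theta> * cos \<theta> - sin \<theta>, s \<theta> * sin \<theta> + cos \<theta>) \<in> asymptotic_field h (cos \<theta>, sin \<theta>) \<and>
    (\<forall>K>0. (\<exists>\<theta>1\<in>{a<..<\<theta>}. K \<le> \<rho> \<theta>1) \<and> (\<exists>\<theta>2\<in>{\<theta><..<c}. K \<le> \<rho> \<theta>2))"
proof -
  obtain m where m: "homogeneous_polynomial (Suc (Suc m)) h"
    using hyperbolic_polynomial_homogeneous[OF assms(1)] by blast
  note disc = hessian_discriminant_pos[OF assms(1)]
  have pos: "0 < h (cos \<theta>) (sin \<theta>)" if "a < \<theta>" "\<theta> < b" for \<theta>
    using signs(1) that by auto
  have neg: "h (cos \<theta>) (sin \<theta>) < 0" if "b < \<theta>" "\<theta> < c" for \<theta>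
    using signs(2) that by auto
  define n where "n = Suc (Suc m)"
  note dh = homogeneous_polynomial_dx[OF m] homogeneous_polynomial_dy[OF m]
  note ddh = homogeneous_polynomial_dx[OF dh(1)] homogeneous_polynomial_dy[OF dh(1)]
    homogeneous_polynomial_dy[OF dh(2)]
  define hxx hxy hyy where "hxx \<theta> = dx (dx h) (cos \<theta>) (sin \<theta>)"
    and "hxy \<theta> = dy (dx h) (cos \<theta>) (sin \<theta>)" and "hyy \<theta> = dy (dy h) (cos \<theta>) (sin \<theta>)" for \<theta>
  define F F' where "F \<theta> = h (cos \<theta>) (sin \<theta>)"
    and "F' \<theta> = cos \<theta> * dy h (cos \<theta>) (sin \<theta>) - sin \<theta> * dx h (cos \<theta>) (sin \<theta>)" for \<theta>
  define P A C where "P \<theta> = hxx \<theta> * (cos \<theta>)\<^sup>2 + 2 * hxy \<theta> * cos \<theta> * sin \<theta> + hyy \<theta> * (sin \<theta>)\<^sup>2"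
    and "A \<theta> = hxy \<theta> * ((cos \<theta>)\<^sup>2 - (sin \<theta>)\<^sup>2) + (hyy \<theta> - hxx \<theta>) * cos \<theta> * sin \<theta>"
    and "C \<theta> = hxx \<theta> * (sin \<theta>)\<^sup>2 - 2 * hxy \<theta> * cos \<theta> * sin \<theta> + hyy \<theta> * (cos \<theta>)\<^sup>2" for \<theta>
  define r where "r \<theta> = sqrt (hessian_discriminant h (cos \<theta>) (sin \<theta>))" for \<theta>
  define s where "s \<theta> = (C \<theta> * (r \<theta> - A \<theta>) - (A \<theta> + r \<theta>) * P \<theta>) / ((P \<theta>)\<^sup>2 + (r \<theta> - A \<theta>)\<^sup>2)" for \<theta>
  have unit: "(cos \<theta>)\<^sup>2 + (sin \<theta>)\<^sup>2 = 1" for \<theta> :: real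
    by simp
  have r: "0 < r \<theta>" "(r \<theta>)\<^sup>2 = (hxy \<theta>)\<^sup>2 - hxx \<theta> * hyy \<theta>" for \<theta>
  proof -
    have "(cos \<theta>, sin \<theta>) \<noteq> (0, 0)"
      using sin_zero_abs_cos_one[of \<theta>] by auto
    then show "0 < r \<theta>" "(r \<theta>)\<^sup>2 = (hxy \<theta>)\<^sup>2 - hxx \<theta> * hyy \<theta>"
      using disc[of "cos \<theta>" "sin \<theta>"]
      by (auto simp: r_def hessian_discriminant_def hxx_def hxy_def hyy_def)
  qed
  have F': "(F has_real_derivative F' \<theta>) (at \<theta>)" for \<theta>
    unfolding F_def F'_def by (rule homogeneous_polynomial_polar_derivative[OF m])
  have PF: "P \<theta> = real n * ((real m + 1) * F \<theta>)" and AF: "A \<theta> = (real m + 1) * F' \<theta>" for \<theta>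
  proof -
    have 0: "cos \<theta> * dx h (cos \<theta>) (sin \<theta>) + sin \<theta> * dy h (cos \<theta>) (sin \<theta>) = real n * F \<theta>"
      unfolding F_def n_def by (rule euler_identity[OF m])
    have 1: "cos \<theta> * hxx \<theta> + sin \<theta> * hxy \<theta> = (real m + 1) * dx h (cos \<theta>) (sin \<theta>)"
      using euler_identity[OF dh(1)] by (simp add: hxx_def hxy_def)
    have 2: "cos \<theta> * hxy \<theta> + sin \<theta> * hyy \<theta> = (real m + 1) * dy h (cos \<theta>) (sin \<theta>)"
      using euler_identity[OF dh(2)] dx_dy_commute[OF m] by (simp add: hyy_def hxy_def)
    show "P \<theta> = real n * ((real m + 1) * F \<theta>)"
      unfolding P_def using 0 1 2 by algebra
    show "A \<theta> = (real m + 1) * F' \<theta>"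
      unfolding A_def F'_def using 1 2 by algebra
  qed
  \<comment> \<open>P vanishes at b, but F changes from positive to negative there, so A <= 0 < r
    keeps r - A, and with it the denominator of s, away from 0.\<close>
  have F'b: "F' b \<le> 0"
    using derivative_nonneg_right[OF DERIV_minus[OF F'] \<open>b < c\<close>] signs(2) zero(2)
    by (auto simp: F_def less_imp_le)
  have nz: "(P \<theta>)\<^sup>2 + (r \<theta> - A \<theta>)\<^sup>2 \<noteq> 0" if "a < \<theta>" "\<theta> < c" for \<theta>
  proof (cases "\<theta> = b")
    case True
    have "A b \<le> 0"
      unfolding AF using F'b by (simp add: mult_nonneg_nonpos)
    then have "r \<theta> - A \<theta> \<noteq> 0"
      using r(1)[of b] True by simp
    then show ?thesis
      by (simp add: sum_power2_eq_zero_iff)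
  next
    case False
    then have "F \<theta> \<noteq> 0"
      using pos[of \<theta>] neg[of \<theta>] that by (auto simp: F_def neq_iff)
    then have "P \<theta> \<noteq> 0"
      unfolding PF by (auto simp: n_def add_eq_0_iff2)
    then show ?thesis
      by (simp add: sum_power2_eq_zero_iff)
  qed
  note slope = slope_asymptotic_direction[OF unit r(2) P_def A_def C_def nz s_def]
  have dir: "(s \<theta> * cos \<theta> - sin \<theta>, s \<theta> * sin \<theta> + cos \<theta>) \<in> asymptotic_field h (cos \<theta>, sin \<theta>)"
    if "a < \<theta>" "\<theta> < c" for \<theta>
    using slope(2,3)[OF that] by (simp add: asymptotic_field_def hxx_def hxy_def hyy_def r_def)
  have cont: "continuous_on UNIV hxx" "continuous_on UNIV hxy" "continuous_on UNIV hyy"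
    unfolding hxx_def hxy_def hyy_def
    by (rule continuous_on_homogeneous_polynomial ddh continuous_intros)+
  then have contr: "continuous_on UNIV r"
    unfolding r_def hessian_discriminant_def hxx_def hxy_def hyy_def by (intro continuous_intros)
  have conts: "isCont s \<theta>" if "a < \<theta>" "\<theta> < c" for \<theta>
  proof -
    have "isCont hxx \<theta>" "isCont hxy \<theta>" "isCont hyy \<theta>" "isCont r \<theta>"
      using cont contr by (auto simp: continuous_on_eq_continuous_at)
    moreover from this have "isCont P \<theta>" "isCont A \<theta>" "isCont C \<theta>"
      unfolding P_def A_def C_def by (auto intro!: continuous_intros)
    ultimately show ?thesis
      unfolding s_def using nz[OF that] by (intro continuous_intros) auto
  qed
  have "ereal a < ereal c"
    using \<open>a < b\<close> \<open>b < c\<close> by simp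
  from einterval_antiderivative[OF this, of s] conts obtain G where
    G: "\<And>\<theta>. a < \<theta> \<Longrightarrow> \<theta> < c \<Longrightarrow> (G has_vector_derivative s \<theta>) (at \<theta>)"
    by auto
  \<comment> \<open>The exponential turns an antiderivative of s into a solution of the linear
    equation for the radius.\<close>
  define \<rho> where "\<rho> \<theta> = exp (G \<theta>)" for \<theta>
  have \<rho>pos: "0 < \<rho> \<theta>" for \<theta>
    by (simp add: \<rho>_def)
  have \<rho>': "(\<rho> has_real_derivative \<rho> \<theta> * s \<theta>) (at \<theta>)" if "a < \<theta>" "\<theta> < c" for \<theta>
    using G[OF that] unfolding \<rho>_def has_real_derivative_iff_has_vector_derivative[symmetric]
    by (auto intro!: derivative_eq_intros)
  \<comment> \<open>This is h along the leaf. Since (n-1) n F = P and (n-1) F' = A, its derivative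
    contains the bracket s P + A, which is - r by \<open>slope(1)\<close>.\<close>
  define H where "H \<theta> = \<rho> \<theta> ^ n * F \<theta>" for \<theta>
  have H': "(H has_real_derivative - (\<rho> \<theta> ^ n * r \<theta> / (real m + 1))) (at \<theta>)"
    if "a < \<theta>" "\<theta> < c" for \<theta>
  proof -
    have "(H has_real_derivative
        real n * (\<rho> \<theta> * s \<theta>) * \<rho> \<theta> ^ (n - 1) * F \<theta> + \<rho> \<theta> ^ n * F' \<theta>) (at \<theta>)"
      unfolding H_def using \<rho>'[OF that] F'[of \<theta>] by (auto intro!: derivative_eq_intros)
    also have "real n * (\<rho> \<theta> * s \<theta>) * \<rho> \<theta> ^ (n - 1) * F \<theta> + \<rho> \<theta> ^ n * F' \<theta> =
        \<rho> \<theta> ^ n * (s \<theta> * P \<theta> + A \<theta>) / (real m + 1)"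
      by (simp add: PF AF n_def field_simps)
    finally show ?thesis
      by (simp add: slope(1)[OF that])
  qed
  have H: "H \<theta>2 < H \<theta>1" if "a < \<theta>1" "\<theta>1 < \<theta>2" "\<theta>2 < c" for \<theta>1 \<theta>2
  proof (rule DERIV_neg_imp_decreasing[OF \<open>\<theta>1 < \<theta>2\<close>])
    fix \<theta> assume "\<theta>1 \<le> \<theta>" "\<theta> \<le> \<theta>2"
    then have "(H has_real_derivative - (\<rho> \<theta> ^ n * r \<theta> / (real m + 1))) (at \<theta>)"
      using that by (intro H') auto
    moreover have "- (\<rho> \<theta> ^ n * r \<theta> / (real m + 1)) < 0"
      using \<rho>pos[of \<theta>] r(1)[of \<theta>] by simp
    ultimately show "\<exists>y. (H has_real_derivative y) (at \<theta>) \<and> y < 0"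
      by blast
  qed
  \<comment> \<open>Since |H| = \<rho>^n |F|, the radius must be large wherever F is small and H is
    not.\<close>
  have large: "K \<le> \<rho> \<theta>" if "K ^ n * \<bar>F \<theta>\<bar> < \<bar>H \<theta>\<bar>" "0 < K" for \<theta> K
  proof -
    have "K ^ n * \<bar>F \<theta>\<bar> < \<rho> \<theta> ^ n * \<bar>F \<theta>\<bar>"
      using that(1) \<rho>pos[of \<theta>] by (simp add: H_def abs_mult)
    then have "K ^ n < \<rho> \<theta> ^ n"
      by (rule mult_right_less_imp_less) simp
    then show ?thesis
      using power_less_imp_less_base[OF _ less_imp_le[OF \<rho>pos]] by (simp add: less_imp_le)
  qed
  have small: "((\<lambda>\<theta>. K ^ n * \<bar>F \<theta>\<bar>) \<longlongrightarrow> 0) (at d within S)" if "F d = 0" for K d S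
  proof -
    have "(F \<longlongrightarrow> F d) (at d within S)"
      using DERIV_isCont[OF F'] unfolding isCont_def by (rule tendsto_within_subset) simp
    then show ?thesis
      using that by (auto intro!: tendsto_eq_intros)
  qed
  have left: "\<exists>\<theta>1\<in>{a<..<\<theta>}. K \<le> \<rho> \<theta>1" if "a < \<theta>" "\<theta> < c" "0 < K" for \<theta> K
  proof -
    \<comment> \<open>To the left of both \<theta> and b, H is positive, and it only grows towards
      a, while F tends to 0.\<close>
    define \<eta> where "\<eta> = (a + min \<theta> b) / 2"
    have \<eta>: "a < \<eta>" "\<eta> < \<theta>" "\<eta> < b"
      using that \<open>a < b\<close> by (auto simp: \<eta>_def min_def)
    have "0 < H \<eta>"
      using pos[OF \<eta>(1,3)] \<rho>pos[of \<eta>] by (simp add: H_def F_def)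
    then have "\<forall>\<^sub>F t in at_right a. K ^ n * \<bar>F t\<bar> < H \<eta>"
      using zero by (intro order_tendstoD(2)[OF small]) (auto simp: F_def)
    moreover have "\<forall>\<^sub>F t in at_right a. t \<in> {a<..<\<eta>}"
      by (rule eventually_at_right_real[OF \<eta>(1)])
    ultimately have "\<forall>\<^sub>F t in at_right a. K ^ n * \<bar>F t\<bar> < H \<eta> \<and> t \<in> {a<..<\<eta>}"
      by (rule eventually_conj)
    then obtain t where t: "K ^ n * \<bar>F t\<bar> < H \<eta>" "a < t" "t < \<eta>"
      using eventually_happens'[OF trivial_limit_at_right_real] by fastforce
    then have "K \<le> \<rho> t"
      using H[of t \<eta>] \<eta> \<open>b < c\<close> \<open>0 < K\<close> by (intro large) auto
    then show ?thesis
      using t \<eta> by (intro bexI[of _ t]) auto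
  qed
  have right: "\<exists>\<theta>2\<in>{\<theta><..<c}. K \<le> \<rho> \<theta>2" if "a < \<theta>" "\<theta> < c" "0 < K" for \<theta> K
  proof -
    define \<eta> where "\<eta> = (max \<theta> b + c) / 2"
    have \<eta>: "\<theta> < \<eta>" "b < \<eta>" "\<eta> < c"
      using that \<open>b < c\<close> by (auto simp: \<eta>_def max_def)
    have "0 < - H \<eta>"
      using neg[OF \<eta>(2,3)] \<rho>pos[of \<eta>] by (simp add: H_def F_def mult_pos_neg)
    then have "\<forall>\<^sub>F t in at_left c. K ^ n * \<bar>F t\<bar> < - H \<eta>"
      using zero by (intro order_tendstoD(2)[OF small]) (auto simp: F_def)
    moreover have "\<forall>\<^sub>F t in at_left c. t \<in> {\<eta><..<c}"
      by (rule eventually_at_left_real[OF \<eta>(3)])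
    ultimately have "\<forall>\<^sub>F t in at_left c. K ^ n * \<bar>F t\<bar> < - H \<eta> \<and> t \<in> {\<eta><..<c}"
      by (rule eventually_conj)
    then obtain t where t: "K ^ n * \<bar>F t\<bar> < - H \<eta>" "\<eta> < t" "t < c"
      using eventually_happens'[OF trivial_limit_at_left_real] by fastforce
    then have "K \<le> \<rho> t"
      using H[of \<eta> t] \<eta> \<open>a < b\<close> \<open>0 < K\<close> by (intro large) auto
    then show ?thesis
      using t \<eta> by (intro bexI[of _ t]) auto
  qed
  show ?thesis
    by (intro exI[of _ \<rho>] exI[of _ s] ballI conjI allI impI) (simp_all add: \<rho>pos \<rho>' conts dir left right)
qed

section \<open>Points of the plane, their angles and the exit from a disc\<close>

lemma norm_circle_point: "norm (circle_point r a) = \<bar>r\<bar>"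
proof -
  have "(r * cos a)\<^sup>2 + (r * sin a)\<^sup>2 = r\<^sup>2 * ((cos a)\<^sup>2 + (sin a)\<^sup>2)"
    by (simp only: power_mult_distrib distrib_left)
  then show ?thesis
    by (simp add: circle_point_def norm_Pair)
qed

lemma circle_point_eq_imp_angle_eq:
  assumes "circle_point r a = circle_point r' b" and "0 < r" "0 < r'" and "\<bar>a - b\<bar> < 2 * pi"
  shows "a = b"
proof -
  have "r = r'"
    using arg_cong[OF assms(1), of norm] assms(2,3) by (simp add: norm_circle_point)
  then have "sin a = sin b \<and> cos a = cos b"
    using assms by (auto simp: circle_point_def)
  then obtain n :: int where n: "a = b + 2 * pi * n"
    unfolding sin_cos_eq_iff by blast
  then have "2 * pi * \<bar>real_of_int n\<bar> < 2 * pi * 1"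
    using assms(4) by (simp add: abs_mult)
  then have "\<bar>real_of_int n\<bar> < 1"
    by (subst (asm) mult_less_cancel_left_pos) auto
  then have "n = 0"
    by linarith
  then show ?thesis
    using n by simp
qed

lemma obtain_circle_point:
  assumes "p \<noteq> 0"
  obtains \<theta> where "a \<le> \<theta>" "\<theta> < a + 2 * pi" "p = circle_point (norm p) \<theta>"
proof -
  obtain x y where p: "p = (x, y)"
    by (cases p)
  define N where "N = norm p"
  have N: "N > 0" "x\<^sup>2 + y\<^sup>2 = N\<^sup>2"
    using assms unfolding N_def zero_less_norm_iff by (simp_all add: p norm_Pair)
  have cs: "(cos a)\<^sup>2 + (sin a)\<^sup>2 = 1"
    by simp
  \<comment> \<open>These are the coordinates of p after a rotation by - a, so that the angle is
    counted from a.\<close>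
  have "(x * cos a + y * sin a)\<^sup>2 + (y * cos a - x * sin a)\<^sup>2 = N\<^sup>2"
    using N(2) cs by algebra
  then have "((x * cos a + y * sin a) / N)\<^sup>2 + ((y * cos a - x * sin a) / N)\<^sup>2 = 1"
    using N(1) by (simp add: power_divide flip: add_divide_distrib)
  then obtain t where t: "0 \<le> t" "t < 2 * pi" "(x * cos a + y * sin a) / N = cos t"
    "(y * cos a - x * sin a) / N = sin t"
    by (rule sincos_total_2pi)
  then have "x * cos a + y * sin a = N * cos t" "y * cos a - x * sin a = N * sin t"
    using N(1) by (auto simp: field_simps)
  then have "x = N * cos (a + t)" "y = N * sin (a + t)"
    using cs unfolding cos_add sin_add by algebra+
  then have "p = circle_point N (a + t)"
    by (simp only: p circle_point_def)
  then show thesis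
    using that[of "a + t"] t(1,2) by (simp add: N_def)
qed

lemma consecutive_interval_cover:
  fixes \<alpha> :: "nat \<Rightarrow> real"
  assumes "\<alpha> 0 \<le> \<theta>" "\<theta> < \<alpha> n"
  shows "\<exists>i<n. \<alpha> i \<le> \<theta> \<and> \<theta> < \<alpha> (Suc i)"
  using assms(2)
proof (induction n)
  case 0
  then show ?case
    using assms(1) by simp
next
  case (Suc n)
  then show ?case
    by (cases "\<theta> < \<alpha> n") (auto intro: less_SucI)
qed

text \<open>The radius of a leaf need not be monotone, so merely some later time on the circle would
  not do: the arc up to it could leave the disc. The least such time exists because the level set is
  compact.\<close>

lemma first_exit:
  fixes \<rho> :: "real \<Rightarrow> real"
  assumes "continuous_on {a..b} \<rho>" "a < b" "\<rho> a < e" "e \<le> \<rho> b"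
  shows "\<exists>t\<in>{a<..b}. \<rho> t = e \<and> (\<forall>u\<in>{a..t}. \<rho> u \<le> e)"
proof -
  define S where "S = {a..b} \<inter> \<rho> -` {e}"
  have "closed S"
    unfolding S_def using assms(1) by (intro continuous_closed_preimage) auto
  then have "compact ({a..b} \<inter> S)"
    by (intro compact_Int_closed compact_Icc)
  then have "compact S"
    by (simp add: S_def)
  moreover have "S \<noteq> {}"
    using IVT'[of \<rho> a e b] assms by (auto simp: S_def)
  ultimately obtain t where t: "t \<in> S" "\<And>u. u \<in> S \<Longrightarrow> t \<le> u"
    by (meson compact_attains_inf)
  have "t \<le> b" "\<rho> t = e" "a < t"
    using t(1) assms(3) by (auto simp: S_def less_le)
  moreover have "\<rho> u \<le> e" if "a \<le> u" "u \<le> t" for u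
  proof (rule ccontr)
    assume u: "\<not> \<rho> u \<le> e"
    have "continuous_on {a..u} \<rho>"
      using assms(1) by (rule continuous_on_subset) (use that \<open>t \<le> b\<close> in auto)
    \<comment> \<open>An excess at u would force the level e at some v <= u, and minimality of t
      leaves only u = t.\<close>
    then have *: "\<exists>v\<ge>a. v \<le> u \<and> \<rho> v = e"
      using u assms(3) that(1) by (intro IVT') auto
    then obtain v where v: "a \<le> v" "v \<le> u" "\<rho> v = e"
      by blast
    then have "t \<le> v"
      using t(2)[of v] that \<open>t \<le> b\<close> by (auto simp: S_def)
    then have "u = t"
      using v that by linarith
    then show False
      using u \<open>\<rho> t = e\<close> by simp
  qed
  ultimately show ?thesis
    by (intro bexI[of _ t]) auto
qed

lemma first_exit_backwards:
  fixes \<rho> :: "real \<Rightarrow> real"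
  assumes "continuous_on {a..b} \<rho>" "a < b" "\<rho> b < e" "e \<le> \<rho> a"
  shows "\<exists>t\<in>{a..<b}. \<rho> t = e \<and> (\<forall>u\<in>{t..b}. \<rho> u \<le> e)"
proof -
  have "continuous_on {- b..- a} (\<lambda>t. \<rho> (- t))"
    by (rule continuous_on_compose2[OF assms(1)]) (auto intro: continuous_intros)
  then have "\<exists>t\<in>{- b<..- a}. \<rho> (- t) = e \<and> (\<forall>u\<in>{- b..t}. \<rho> (- u) \<le> e)"
    by (rule first_exit) (use assms in auto)
  then obtain t where t: "t \<in> {- b<..- a}" "\<rho> (- t) = e" "\<forall>u\<in>{- b..t}. \<rho> (- u) \<le> e"
    by auto
  have "\<rho> u \<le> e" if "u \<in> {- t..b}" for u
    using t(3)[rule_format, of "- u"] that by simp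
  then show ?thesis
    using t(1,2) by (intro bexI[of _ "- t"]) auto
qed

text \<open>A dilation of the single leaf from \<open>polar_leaf\<close> passes through the given
  point. It is followed in both directions until it meets the circle of radius e for the first
  time.\<close>

lemma crossing_curve:
  fixes a b c :: real
  assumes "hyperbolic_polynomial h" and "a < b" "b < c"
    and "h (cos a) (sin a) = 0" "h (cos b) (sin b) = 0" "h (cos c) (sin c) = 0"
    and "\<forall>\<theta>\<in>{a<..<b}. 0 < h (cos \<theta>) (sin \<theta>)" "\<forall>\<theta>\<in>{b<..<c}. h (cos \<theta>) (sin \<theta>) < 0"
    and "a < \<phi>" "\<phi> < c" "0 < q" "q < e"
  shows "\<exists>\<gamma>. integral_curve (asymptotic_field h) {0..1} \<gamma> \<and>
    circle_point q \<phi> \<in> \<gamma> ` {0..1} \<and> norm (\<gamma> 0) = e \<and> norm (\<gamma> 1) = e \<and>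
    \<gamma> ` {0..1} \<subseteq> {circle_point r \<theta> | r \<theta>. 0 < r \<and> r \<le> e \<and> a < \<theta> \<and> \<theta> < c}"
proof -
  obtain m where m: "homogeneous_polynomial (Suc (Suc m)) h"
    using hyperbolic_polynomial_homogeneous[OF assms(1)] by blast
  obtain \<rho> s where leaf: "\<forall>\<theta>\<in>{a<..<c}. 0 < \<rho> \<theta> \<and>
      (\<rho> has_real_derivative \<rho> \<theta> * s \<theta>) (at \<theta>) \<and> isCont s \<theta> \<and>
      (s \<theta> * cos \<theta> - sin \<theta>, s \<theta> * sin \<theta> + cos \<theta>) \<in> asymptotic_field h (cos \<theta>, sin \<theta>) \<and>
      (\<forall>K>0. (\<exists>\<theta>1\<in>{a<..<\<theta>}. K \<le> \<rho> \<theta>1) \<and> (\<exists>\<theta>2\<in>{\<theta><..<c}. K \<le> \<rho> \<theta>2))"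
    using polar_leaf[OF assms(1-8)] by blast
  have \<rho>pos: "0 < \<rho> \<theta>"
    and \<rho>': "(\<rho> has_real_derivative \<rho> \<theta> * s \<theta>) (at \<theta>)"
    and conts: "isCont s \<theta>"
    and dir: "(s \<theta> * cos \<theta> - sin \<theta>, s \<theta> * sin \<theta> + cos \<theta>) \<in> asymptotic_field h (cos \<theta>, sin \<theta>)"
    if "a < \<theta>" "\<theta> < c" for \<theta>
    using leaf that by auto
  \<comment> \<open>The dilation factor that moves the leaf through the point at angle \<phi> and
    radius q.\<close>
  define \<kappa> where "\<kappa> = q / \<rho> \<phi>"
  have \<kappa>: "\<kappa> > 0" "\<kappa> * \<rho> \<phi> = q"
    using \<rho>pos[of \<phi>] assms(9-11) by (auto simp: \<kappa>_def)
  define \<sigma> where "\<sigma> \<theta> = \<kappa> * \<rho> \<theta>" for \<theta>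
  have \<sigma>pos: "0 < \<sigma> \<theta>" if "a < \<theta>" "\<theta> < c" for \<theta>
    using \<rho>pos[OF that] \<kappa>(1) by (simp add: \<sigma>_def)
  have \<sigma>': "(\<sigma> has_real_derivative \<sigma> \<theta> * s \<theta>) (at \<theta>)" if "a < \<theta>" "\<theta> < c" for \<theta>
    unfolding \<sigma>_def using \<rho>'[OF that] by (auto intro!: derivative_eq_intros)
  have cont\<sigma>: "continuous_on T \<sigma>" if "T \<subseteq> {a<..<c}" for T
    using that DERIV_isCont[OF \<sigma>'] by (intro continuous_at_imp_continuous_on) auto
  have "0 < e / \<kappa>"
    using \<kappa>(1) assms(11,12) by simp
  then have "\<exists>\<theta>1\<in>{a<..<\<phi>}. e / \<kappa> \<le> \<rho> \<theta>1" "\<exists>\<theta>2\<in>{\<phi><..<c}. e / \<kappa> \<le> \<rho> \<theta>2"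
    using leaf assms(9,10) by auto
  then obtain \<theta>1 \<theta>2 where
    "a < \<theta>1" "\<theta>1 < \<phi>" "e / \<kappa> \<le> \<rho> \<theta>1" "\<phi> < \<theta>2" "\<theta>2 < c" "e / \<kappa> \<le> \<rho> \<theta>2"
    by auto
  then have \<theta>: "a < \<theta>1" "\<theta>1 < \<phi>" "e \<le> \<sigma> \<theta>1" "\<phi> < \<theta>2" "\<theta>2 < c" "e \<le> \<sigma> \<theta>2"
    using \<kappa>(1) by (auto simp: \<sigma>_def field_simps)
  have \<sigma>\<phi>: "\<sigma> \<phi> < e"
    using \<kappa>(2) assms(12) by (simp add: \<sigma>_def)
  have "\<exists>t1\<in>{\<theta>1..<\<phi>}. \<sigma> t1 = e \<and> (\<forall>u\<in>{t1..\<phi>}. \<sigma> u \<le> e)"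
    by (rule first_exit_backwards[OF cont\<sigma> \<theta>(2) \<sigma>\<phi> \<theta>(3)]) (use \<theta> assms(10) in auto)
  then obtain t1 where t1: "\<theta>1 \<le> t1" "t1 < \<phi>" "\<sigma> t1 = e" "\<forall>u\<in>{t1..\<phi>}. \<sigma> u \<le> e"
    by auto
  have "\<exists>t2\<in>{\<phi><..\<theta>2}. \<sigma> t2 = e \<and> (\<forall>u\<in>{\<phi>..t2}. \<sigma> u \<le> e)"
    by (rule first_exit[OF cont\<sigma> \<theta>(4) \<sigma>\<phi> \<theta>(6)]) (use \<theta> assms(9) in auto)
  then obtain t2 where t2: "\<phi> < t2" "t2 \<le> \<theta>2" "\<sigma> t2 = e" "\<forall>u\<in>{\<phi>..t2}. \<sigma> u \<le> e"
    by auto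
  \<comment> \<open>Affine reparametrisation of the angle interval {t1..t2} by {0..1}.\<close>
  define w where "w t = t1 + t * (t2 - t1)" for t
  define \<gamma> where "\<gamma> t = circle_point (\<sigma> (w t)) (w t)" for t
  have w: "t1 \<le> w t" "w t \<le> t2" "a < w t" "w t < c" if "t \<in> {0..1}" for t
  proof -
    have "0 \<le> t * (t2 - t1)" "t * (t2 - t1) \<le> 1 * (t2 - t1)"
      using that t1(2) t2(1) by (auto intro!: mult_right_mono)
    then show "t1 \<le> w t" "w t \<le> t2" "a < w t" "w t < c"
      using t1(1) t2(2) \<theta>(1,5) by (auto simp: w_def)
  qed
  have w': "(w has_real_derivative (t2 - t1)) (at t)" for t
    unfolding w_def by (auto intro!: derivative_eq_intros)
  define \<gamma>' where "\<gamma>' t = ((t2 - t1) * \<sigma> (w t)) *\<^sub>R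
    (s (w t) * cos (w t) - sin (w t), s (w t) * sin (w t) + cos (w t))" for t
  have "(\<gamma> has_vector_derivative \<gamma>' t) (at t within {0..1})" if t: "t \<in> {0..1}" for t
  proof -
    have \<sigma>w: "((\<lambda>t. \<sigma> (w t)) has_real_derivative \<sigma> (w t) * s (w t) * (t2 - t1)) (at t)"
      using DERIV_chain2[OF \<sigma>'[OF w(3,4)[OF t]] w'] .
    have "((\<lambda>t. \<sigma> (w t) * cos (w t)) has_real_derivative fst (\<gamma>' t)) (at t)"
      "((\<lambda>t. \<sigma> (w t) * sin (w t)) has_real_derivative snd (\<gamma>' t)) (at t)"
      using \<sigma>w w'[of t] unfolding \<gamma>'_def
      by (auto intro!: derivative_eq_intros simp: algebra_simps)
    then have "((\<lambda>t. (\<sigma> (w t) * cos (w t), \<sigma> (w t) * sin (w t))) has_vector_derivative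
        (fst (\<gamma>' t), snd (\<gamma>' t))) (at t)"
      unfolding has_real_derivative_iff_has_vector_derivative by (rule has_vector_derivative_Pair)
    then show ?thesis
      unfolding \<gamma>_def circle_point_def by (simp add: has_vector_derivative_at_within)
  qed
  moreover have "continuous_on {0..1} \<gamma>'"
  proof -
    have contw: "continuous_on {0..1} w"
      unfolding w_def by (intro continuous_intros)
    have "continuous_on {a<..<c} s"
      using conts by (intro continuous_at_imp_continuous_on) auto
    then have "continuous_on {0..1} (\<lambda>t. s (w t))"
      by (rule continuous_on_compose2[OF _ contw]) (use w in auto)
    moreover have "continuous_on {0..1} (\<lambda>t. \<sigma> (w t))"
      by (rule continuous_on_compose2[OF cont\<sigma>[OF order_refl] contw]) (use w in auto)
    ultimately show ?thesis
      unfolding \<gamma>'_def using contw by (intro continuous_intros)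
  qed
  moreover have "\<gamma> t \<noteq> 0" "\<gamma>' t \<noteq> 0" "\<gamma>' t \<in> asymptotic_field h (\<gamma> t)" if t: "t \<in> {0..1}" for t
  proof -
    note wt = w(3,4)[OF t]
    have "norm (\<gamma> t) \<noteq> 0"
      using \<sigma>pos[OF wt] by (simp add: \<gamma>_def norm_circle_point)
    then show "\<gamma> t \<noteq> 0"
      by simp
    \<comment> \<open>The vector has angular component 1, whatever the slope is.\<close>
    have "s (w t) * cos (w t) - sin (w t) \<noteq> 0 \<or> s (w t) * sin (w t) + cos (w t) \<noteq> 0"
    proof (rule ccontr)
      assume "\<not> ?thesis"
      then have "s (w t) * cos (w t) - sin (w t) = 0" "s (w t) * sin (w t) + cos (w t) = 0"
        "(cos (w t))\<^sup>2 + (sin (w t))\<^sup>2 = 1"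
        by auto
      then show False
        by algebra
    qed
    then show "\<gamma>' t \<noteq> 0"
      using \<sigma>pos[OF wt] t1(2) t2(1) by (auto simp: \<gamma>'_def zero_prod_def)
    show "\<gamma>' t \<in> asymptotic_field h (\<gamma> t)"
      unfolding \<gamma>'_def \<gamma>_def circle_point_def
      by (rule asymptotic_field_scale[OF m \<sigma>pos[OF wt] dir[OF wt]])
  qed
  ultimately have "integral_curve (asymptotic_field h) {0..1} \<gamma>"
    unfolding integral_curve_def by blast
  moreover have "circle_point q \<phi> \<in> \<gamma> ` {0..1}"
  proof
    have "w ((\<phi> - t1) / (t2 - t1)) = \<phi>"
      using t1(2) t2(1) by (simp add: w_def)
    then show "circle_point q \<phi> = \<gamma> ((\<phi> - t1) / (t2 - t1))"
      using \<kappa>(2) by (simp add: \<gamma>_def \<sigma>_def)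
    show "(\<phi> - t1) / (t2 - t1) \<in> {0..1}"
      using t1(2) t2(1) by simp
  qed
  moreover have "norm (\<gamma> 0) = e" "norm (\<gamma> 1) = e"
    using t1(3) t2(3) assms(11,12) by (auto simp: \<gamma>_def w_def norm_circle_point)
  moreover have "\<gamma> ` {0..1} \<subseteq> {circle_point r \<theta> | r \<theta>. 0 < r \<and> r \<le> e \<and> a < \<theta> \<and> \<theta> < c}"
  proof
    fix x assume "x \<in> \<gamma> ` {0..1}"
    then obtain t where t: "t \<in> {0..1}" "x = \<gamma> t"
      by blast
    have "\<sigma> (w t) \<le> e"
      using t1(4) t2(4) w(1,2)[OF t(1)] by (cases "w t \<le> \<phi>") auto
    then show "x \<in> {circle_point r \<theta> | r \<theta>. 0 < r \<and> r \<le> e \<and> a < \<theta> \<and> \<theta> < c}"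
      using w[OF t(1)] \<sigma>pos[of "w t"] t(2) by (auto simp: \<gamma>_def)
  qed
  ultimately show ?thesis
    by blast
qed

section \<open>The sectors of an asymptotic field\<close>

text \<open>Positive values of h just after the zero a give a nonnegative derivative along the
  circle at a, which is what assigns the ray to the first field.\<close>

lemma characteristic_curve_ray:
  assumes "hyperbolic_polynomial h" and "0 < e"
    and "h (cos a) (sin a) = 0" and "a < b" "\<forall>\<theta>\<in>{a<..<b}. 0 < h (cos \<theta>) (sin \<theta>)"
  shows "characteristic_curve (asymptotic_field h) e a (\<lambda>t. circle_point (e * t) a)"
proof -
  obtain m where m: "homogeneous_polynomial (Suc (Suc m)) h"
    using hyperbolic_polynomial_homogeneous[OF assms(1)] by blast
  have ray: "circle_point (e * t) a = t *\<^sub>R circle_point e a" for t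
    by (simp add: circle_point_def)
  have "0 \<le> cos a * dy h (cos a) (sin a) - sin a * dx h (cos a) (sin a)"
    by (rule derivative_nonneg_right[OF homogeneous_polynomial_polar_derivative[OF m] assms(4)])
      (use assms in \<open>auto simp: less_imp_le\<close>)
  then have radial: "(cos a, sin a) \<in> asymptotic_field h (cos a, sin a)"
    by (intro radial_asymptotic_direction assms) auto
  have "norm (circle_point e a) \<noteq> 0"
    using assms(2) by (simp add: norm_circle_point)
  then have nz: "circle_point e a \<noteq> 0"
    by simp
  have "integral_curve (asymptotic_field h) {0<..1} (\<lambda>t. circle_point (e * t) a)"
    unfolding integral_curve_def
  proof (intro exI[of _ "\<lambda>_. circle_point e a"] conjI ballI)
    fix t :: real
    assume t: "t \<in> {0<..1}"
    show "circle_point (e * t) a \<noteq> 0"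
      using t nz unfolding ray by simp
    show "((\<lambda>t. circle_point (e * t) a) has_vector_derivative circle_point e a) (at t within {0<..1})"
      unfolding ray by (auto intro!: derivative_eq_intros)
    show "circle_point e a \<in> asymptotic_field h (circle_point (e * t) a)"
      using asymptotic_field_scale[OF m _ radial, of "e * t" e] t assms(2)
      by (simp add: circle_point_def)
  qed (use nz in auto)
  moreover have "((\<lambda>t. circle_point (e * t) a) \<longlongrightarrow> 0) (at_right 0)"
    unfolding ray by (auto intro!: tendsto_eq_intros)
  ultimately show ?thesis
    using assms(2) unfolding characteristic_curve_def by (simp add: norm_circle_point abs_mult)
qed

text \<open>The angles \<alpha> i carry the rays of the first field, \<beta> i those of the second.
  Infinite sequences continue the zeros past a full turn, so that \<open>\<alpha> (Suc i)\<close>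
  makes sense for the last sector without cyclic indices.\<close>

definition alternating_zeros ::
    "(real \<Rightarrow> real \<Rightarrow> real) \<Rightarrow> nat \<Rightarrow> (nat \<Rightarrow> real) \<Rightarrow> (nat \<Rightarrow> real) \<Rightarrow> bool" where
  "alternating_zeros h n \<alpha> \<beta> \<longleftrightarrow>
     strict_mono \<alpha> \<and> \<alpha> n = \<alpha> 0 + 2 * pi \<and>
     (\<forall>i. \<alpha> i < \<beta> i \<and> \<beta> i < \<alpha> (Suc i) \<and>
       h (cos (\<alpha> i)) (sin (\<alpha> i)) = 0 \<and> h (cos (\<beta> i)) (sin (\<beta> i)) = 0 \<and>
       (\<forall>\<theta>\<in>{\<alpha> i<..<\<beta> i}. 0 < h (cos \<theta>) (sin \<theta>)) \<and>
       (\<forall>\<theta>\<in>{\<beta> i<..<\<alpha> (Suc i)}. h (cos \<theta>) (sin \<theta>) < 0))"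

lemma sectorial_decomposition_asymptotic_field:
  assumes "hyperbolic_polynomial h" and "0 < e" and "0 < n"
    and alt: "alternating_zeros h n \<alpha> \<beta>"
  shows "sectorial_decomposition (asymptotic_field h) e \<alpha> (\<lambda>i t. circle_point (e * t) (\<alpha> i))
    (replicate n Hyperbolic)"
proof -
  have \<alpha>: "strict_mono \<alpha>" "\<alpha> n = \<alpha> 0 + 2 * pi"
    using alt by (auto simp: alternating_zeros_def)
  have \<beta>: "\<alpha> i < \<beta> i" "\<beta> i < \<alpha> (Suc i)"
    and zero: "h (cos (\<alpha> i)) (sin (\<alpha> i)) = 0" "h (cos (\<beta> i)) (sin (\<beta> i)) = 0"
    and signs: "\<forall>\<theta>\<in>{\<alpha> i<..<\<beta> i}. 0 < h (cos \<theta>) (sin \<theta>)"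
      "\<forall>\<theta>\<in>{\<beta> i<..<\<alpha> (Suc i)}. h (cos \<theta>) (sin \<theta>) < 0" for i
    using alt unfolding alternating_zeros_def by blast+
  define L where "L = asymptotic_field h"
  define \<Gamma> where "\<Gamma> = (\<lambda>i t. circle_point (e * t) (\<alpha> i))"
  define Y where "Y = cball 0 e - {0} - (\<Union>j<n. \<Gamma> j ` {0<..1})"
  have range: "\<alpha> 0 \<le> \<alpha> i" "\<alpha> i < \<alpha> 0 + 2 * pi" if "i < n" for i
    unfolding \<alpha>(2)[symmetric] using that
    by (simp_all add: strict_mono_less_eq[OF \<alpha>(1)] strict_mono_less[OF \<alpha>(1)])
  have disjoint: "\<Gamma> i ` {0<..1} \<inter> \<Gamma> j ` {0<..1} = {}" if "i < n" "j < n" "i \<noteq> j" for i j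
  proof -
    have "\<alpha> i \<noteq> \<alpha> j"
      using that(3) strict_mono_eq[OF \<alpha>(1)] by simp
    moreover have "\<bar>\<alpha> i - \<alpha> j\<bar> < 2 * pi"
      using range[OF that(1)] range[OF that(2)] by linarith
    ultimately have "\<Gamma> i t \<noteq> \<Gamma> j t'" if "t \<in> {0<..1}" "t' \<in> {0<..1}" for t t'
      using circle_point_eq_imp_angle_eq[of "e * t" "\<alpha> i" "e * t'" "\<alpha> j"] that assms(2)
      by (auto simp: \<Gamma>_def)
    then show ?thesis
      by blast
  qed
  \<comment> \<open>No description of the regions is needed: the leaf through p is connected and
    avoids the rays, so it stays in whatever component of \<open>Y\<close> contains p.\<close>
  have crossing: "crossing_leaf L e (connected_component_set Y x) p"
    if p: "p \<in> connected_component_set Y x" "p \<in> ball 0 e" for x p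
  proof -
    have "p \<in> Y"
      using p(1) connected_component_subset by blast
    then have "p \<noteq> 0"
      by (simp add: Y_def)
    then obtain \<phi> where \<phi>: "\<alpha> 0 \<le> \<phi>" "\<phi> < \<alpha> 0 + 2 * pi" "p = circle_point (norm p) \<phi>"
      using obtain_circle_point by blast
    then obtain i where i: "i < n" "\<alpha> i \<le> \<phi>" "\<phi> < \<alpha> (Suc i)"
      using consecutive_interval_cover[of \<alpha> \<phi> n] \<alpha>(2) by auto
    have "\<alpha> i \<noteq> \<phi>"
    proof
      assume "\<alpha> i = \<phi>"
      then have "circle_point (norm p) \<phi> = \<Gamma> i (norm p / e)"
        using assms(2) by (simp add: \<Gamma>_def)
      then have "p = \<Gamma> i (norm p / e)"
        unfolding \<phi>(3)[symmetric] .
      moreover have "norm p / e \<in> {0<..1}"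
        using p(2) \<open>p \<noteq> 0\<close> assms(2) by simp
      ultimately have "p \<in> \<Gamma> i ` {0<..1}"
        by (rule image_eqI)
      then show False
        using \<open>p \<in> Y\<close> i(1) by (auto simp: Y_def)
    qed
    then have "\<alpha> i < \<phi>"
      using i(2) by simp
    have "0 < norm p" "norm p < e"
      using p(2) \<open>p \<noteq> 0\<close> by auto
    then have "\<exists>\<gamma>. integral_curve L {0..1} \<gamma> \<and>
      circle_point (norm p) \<phi> \<in> \<gamma> ` {0..1} \<and> norm (\<gamma> 0) = e \<and> norm (\<gamma> 1) = e \<and>
      \<gamma> ` {0..1} \<subseteq> {circle_point r \<theta> | r \<theta>. 0 < r \<and> r \<le> e \<and> \<alpha> i < \<theta> \<and> \<theta> < \<alpha> (Suc i)}"
      unfolding L_def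
      by (rule crossing_curve[OF assms(1) \<beta>[of i] zero[of i] zero(1)[of "Suc i"] signs[of i]
            \<open>\<alpha> i < \<phi>\<close> i(3)])
    then obtain \<gamma> where \<gamma>: "integral_curve L {0..1} \<gamma>" "p \<in> \<gamma> ` {0..1}"
      "norm (\<gamma> 0) = e" "norm (\<gamma> 1) = e"
      "\<gamma> ` {0..1} \<subseteq> {circle_point r \<theta> | r \<theta>. 0 < r \<and> r \<le> e \<and> \<alpha> i < \<theta> \<and> \<theta> < \<alpha> (Suc i)}"
      unfolding \<phi>(3)[symmetric] by (elim exE conjE) (rule that)
    have "circle_point r \<theta> \<in> Y" if "0 < r" "r \<le> e" "\<alpha> i < \<theta>" "\<theta> < \<alpha> (Suc i)" for r \<theta>
    proof -
      have "circle_point r \<theta> \<notin> (\<Union>j<n. \<Gamma> j ` {0<..1})"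
      proof
        assume "circle_point r \<theta> \<in> (\<Union>j<n. \<Gamma> j ` {0<..1})"
        then obtain t j where t: "0 < t" and j: "j < n"
          and eq: "circle_point r \<theta> = circle_point (e * t) (\<alpha> j)"
          unfolding \<Gamma>_def by auto
        \<comment> \<open>Equal points only give equal angles modulo 2 pi. Since the wedge ends at
          most one full turn after \<alpha> 0, \<theta> and \<alpha> j are less than a full turn
          apart.\<close>
        have "\<alpha> (Suc i) \<le> \<alpha> 0 + 2 * pi"
          unfolding \<alpha>(2)[symmetric] using i(1) by (simp add: strict_mono_less_eq[OF \<alpha>(1)])
        then have "\<bar>\<theta> - \<alpha> j\<bar> < 2 * pi"
          using range[OF j] range(1)[OF i(1)] \<open>\<alpha> i < \<theta>\<close> \<open>\<theta> < \<alpha> (Suc i)\<close> by linarith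
        then have "\<theta> = \<alpha> j"
          using circle_point_eq_imp_angle_eq[OF eq] \<open>0 < r\<close> t assms(2) by simp
        then show False
          using \<open>\<alpha> i < \<theta>\<close> \<open>\<theta> < \<alpha> (Suc i)\<close> by (simp add: strict_mono_less[OF \<alpha>(1)])
      qed
      moreover have "norm (circle_point r \<theta>) = r"
        using \<open>0 < r\<close> by (simp add: norm_circle_point)
      moreover from this have "circle_point r \<theta> \<noteq> 0"
        using \<open>0 < r\<close> by auto
      ultimately show ?thesis
        using \<open>r \<le> e\<close> unfolding Y_def by simp
    qed
    then have "{circle_point r \<theta> | r \<theta>. 0 < r \<and> r \<le> e \<and> \<alpha> i < \<theta> \<and> \<theta> < \<alpha> (Suc i)} \<subseteq> Y"
      by auto
    with \<gamma>(5) have "\<gamma> ` {0..1} \<subseteq> Y"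
      by (rule subset_trans)
    moreover obtain \<gamma>' where
      "\<forall>t\<in>{0..1}. (\<gamma> has_vector_derivative \<gamma>' t) (at t within {0..1})"
      using \<gamma>(1) unfolding integral_curve_def by auto
    then have "continuous_on {0..1} \<gamma>"
      by (intro continuous_on_vector_derivative) (rule bspec)
    then have "connected (\<gamma> ` {0..1})"
      by (rule connected_continuous_image) simp
    ultimately have "\<gamma> ` {0..1} \<subseteq> connected_component_set Y p"
      using \<gamma>(2) by (intro connected_component_maximal)
    then have "\<gamma> ` {0..1} \<subseteq> connected_component_set Y x"
      by (simp only: connected_component_eq[OF p(1)])
    then show ?thesis
      unfolding crossing_leaf_def using \<gamma>(1-4) by (intro exI[of _ \<gamma>] conjI)
  qed
  \<comment> \<open>Here \<delta> = e: every point strictly inside the disc lies on a crossing leaf,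
    at any scale.\<close>
  have 1: "has_sector_type L e (sector_region e n \<alpha> \<Gamma> i) Hyperbolic" for i
    unfolding has_sector_type.simps sector_region_def Y_def[symmetric]
    using crossing assms(2) by (intro exI[of _ e] conjI ballI) auto
  have 2: "characteristic_curve L e (\<alpha> i) (\<Gamma> i)" for i
    unfolding L_def \<Gamma>_def by (rule characteristic_curve_ray[OF assms(1,2) zero(1) \<beta>(1) signs(1)])
  have "sectorial_decomposition L e \<alpha> \<Gamma> (replicate n Hyperbolic)"
    unfolding sectorial_decomposition_def using assms(3)
    by (simp add: Let_def 1 2 disjoint \<alpha>(2) strict_mono_less[OF \<alpha>(1)] del: has_sector_type.simps)
  then show ?thesis
    by (simp only: L_def \<Gamma>_def)
qed

text \<open>\<open>alternating_zeros\<close> sees only signs on the unit circle, so both fields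
  admit literally the same rays and the same list of sectors in the disc of radius r / 2.\<close>

lemma same_sectors_asymptotic_fields:
  assumes "hyperbolic_polynomial h" "hyperbolic_polynomial g" and "0 < n"
    and alt: "alternating_zeros g n \<alpha> \<beta>"
    and sgn: "\<And>\<theta>. sgn (h (cos \<theta>) (sin \<theta>)) = sgn (g (cos \<theta>) (sin \<theta>))"
  shows "same_sectors_at_origin (asymptotic_field h) (asymptotic_field g)"
  unfolding same_sectors_at_origin_def
proof (intro allI impI)
  fix r :: real
  assume "0 < r"
  then have e: "r / 2 \<in> {0<..<r}" "0 < r / 2"
    by auto
  have "h (cos \<theta>) (sin \<theta>) = 0 \<longleftrightarrow> g (cos \<theta>) (sin \<theta>) = 0"
    "0 < h (cos \<theta>) (sin \<theta>) \<longleftrightarrow> 0 < g (cos \<theta>) (sin \<theta>)"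
    "h (cos \<theta>) (sin \<theta>) < 0 \<longleftrightarrow> g (cos \<theta>) (sin \<theta>) < 0" for \<theta>
    using sgn[of \<theta>] by (auto simp: sgn_if split: if_splits)
  then have alt': "alternating_zeros h n \<alpha> \<beta>"
    using alt by (simp add: alternating_zeros_def)
  have "sectorial_decomposition (asymptotic_field h) (r / 2) \<alpha>
      (\<lambda>i t. circle_point (r / 2 * t) (\<alpha> i)) (replicate n Hyperbolic)"
    by (rule sectorial_decomposition_asymptotic_field[OF assms(1) e(2) assms(3) alt'])
  moreover have "sectorial_decomposition (asymptotic_field g) (r / 2) \<alpha>
      (\<lambda>i t. circle_point (r / 2 * t) (\<alpha> i)) (replicate n Hyperbolic)"
    by (rule sectorial_decomposition_asymptotic_field[OF assms(2) e(2) assms(3) alt])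
  ultimately show "\<exists>e\<in>{0<..<r}. \<exists>d\<in>{0<..<r}. \<exists>\<alpha> \<beta> \<Gamma> \<Delta> ts us.
      sectorial_decomposition (asymptotic_field h) e \<alpha> \<Gamma> ts \<and>
      sectorial_decomposition (asymptotic_field g) d \<beta> \<Delta> us \<and>
      card (separatrices \<Gamma> ts) = card (separatrices \<Delta> us) \<and> ts = us"
    using e(1) by blast
qed

section \<open>The signs of a product of linear forms on the unit circle\<close>

text \<open>Each factor is a positive multiple of sin (\<theta> i - \<phi>), where cot (\<theta> i)
  = c i. The zeros repeat with period pi, so any n consecutive ones give the same product up to
  sign; for \<phi> between two zeros, the n zeros that follow \<phi> make all sines
  positive.\<close>

lemma product_of_linear_forms_signs:
  fixes c :: "nat \<Rightarrow> real"
  assumes "0 < n" and c: "strict_antimono_on {..<n} c"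
  shows "\<exists>\<theta>. strict_mono \<theta> \<and> (\<forall>j. \<theta> (j + n) = \<theta> j + pi) \<and>
    (\<forall>j. (\<Prod>i<n. cos (\<theta> j) - c i * sin (\<theta> j)) = 0) \<and>
    (\<forall>j. \<forall>\<phi>\<in>{\<theta> j<..<\<theta> (Suc j)}. 0 < (- 1) ^ Suc j * (\<Prod>i<n. cos \<phi> - c i * sin \<phi>))"
proof -
  \<comment> \<open>pi / 2 - arctan is the inverse cotangent with values between 0 and pi; it
    reverses the order of the decreasing \<open>c\<close>. Division by n counts the half
    turns.\<close>
  define \<theta> where "\<theta> j = pi / 2 - arctan (c (j mod n)) + pi * real (j div n)" for j
  have period: "\<theta> (j + n) = \<theta> j + pi" for j
    using assms(1) by (simp add: \<theta>_def algebra_simps)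
  have "\<theta> j < \<theta> (Suc j)" for j
  proof (cases "Suc (j mod n) = n")
    case True
    then have "\<theta> (Suc j) = pi / 2 - arctan (c 0) + pi * (real (j div n) + 1)"
      by (simp add: \<theta>_def mod_Suc div_Suc)
    then show ?thesis
      using arctan_lbound[of "c (j mod n)"] arctan_ubound[of "c 0"]
      by (simp add: \<theta>_def algebra_simps)
  next
    case False
    then have "\<theta> (Suc j) = pi / 2 - arctan (c (Suc (j mod n))) + pi * real (j div n)"
      by (simp add: \<theta>_def mod_Suc div_Suc)
    moreover have "Suc (j mod n) < n"
      using False assms(1) by (simp add: Suc_lessI)
    ultimately show ?thesis
      using monotone_onD[OF c, of "j mod n" "Suc (j mod n)"] by (simp add: \<theta>_def arctan_less_iff)
  qed
  then have mono: "strict_mono \<theta>"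
    by (simp add: strict_mono_Suc_iff)
  define \<kappa> where "\<kappa> = (\<Prod>i<n. sqrt (1 + (c i)\<^sup>2))"
  have sqrt: "0 < sqrt (1 + x\<^sup>2)" for x :: real
    by (simp add: add_pos_nonneg)
  have \<kappa>: "0 < \<kappa>"
    unfolding \<kappa>_def by (intro prod_pos) (use sqrt in auto)
  define W where "W j \<phi> = (\<Prod>i<n. sin (\<theta> (i + j) - \<phi>))" for j \<phi>
  have W0: "(\<Prod>i<n. cos \<phi> - c i * sin \<phi>) = \<kappa> * W 0 \<phi>" for \<phi>
  proof -
    have "cos \<phi> - c i * sin \<phi> = sqrt (1 + (c i)\<^sup>2) * sin (\<theta> (i + 0) - \<phi>)" if "i < n" for i
    proof -
      have "sin (\<theta> i - \<phi>) = (cos \<phi> - c i * sin \<phi>) / sqrt (1 + (c i)\<^sup>2)"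
        using that by (simp add: \<theta>_def sin_diff cos_diff sin_arctan cos_arctan diff_divide_distrib)
      then show ?thesis
        using sqrt[of "c i"] by simp
    qed
    then show ?thesis
      unfolding \<kappa>_def W_def by (simp add: prod.distrib)
  qed
  \<comment> \<open>Moving the window by one zero replaces sin (\<theta> j - \<phi>) by sin
    (\<theta> j + pi - \<phi>), its negative.\<close>
  have W_Suc: "W (Suc j) \<phi> = - W j \<phi>" for j \<phi>
  proof -
    obtain l where l: "n = Suc l"
      using assms(1) gr0_conv_Suc by blast
    have "W (Suc j) \<phi> = (\<Prod>i<l. sin (\<theta> (Suc i + j) - \<phi>)) * sin (\<theta> (j + n) - \<phi>)"
      by (simp add: W_def l add.commute)
    also have "sin (\<theta> (j + n) - \<phi>) = - sin (\<theta> j - \<phi>)"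
      using sin_periodic_pi[of "\<theta> j - \<phi>"] unfolding period by (simp add: algebra_simps)
    also have "(\<Prod>i<l. sin (\<theta> (Suc i + j) - \<phi>)) * - sin (\<theta> j - \<phi>) = - W j \<phi>"
      unfolding W_def l prod.lessThan_Suc_shift by simp
    finally show ?thesis .
  qed
  have W: "W 0 \<phi> = (- 1) ^ j * W j \<phi>" for j \<phi>
    by (induction j) (simp_all add: W_Suc)
  show ?thesis
  proof (intro exI[of _ \<theta>] conjI allI ballI)
    show "strict_mono \<theta>" "\<theta> (j + n) = \<theta> j + pi" for j
      by (fact mono period)+
  next
    fix j
    have "W j (\<theta> j) = 0"
      unfolding W_def using assms(1) by (intro prod_zero bexI[of _ 0]) auto
    then show "(\<Prod>i<n. cos (\<theta> j) - c i * sin (\<theta> j)) = 0"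
      unfolding W0 W[of _ j] by simp
  next
    fix j \<phi>
    assume \<phi>: "\<phi> \<in> {\<theta> j<..<\<theta> (Suc j)}"
    have "0 < sin (\<theta> (i + Suc j) - \<phi>)" if "i < n" for i
    proof (rule sin_gt_zero)
      have "\<theta> (Suc j) \<le> \<theta> (i + Suc j)" "\<theta> (i + Suc j) \<le> \<theta> (j + n)"
        using mono that by (auto simp: strict_mono_less_eq)
      then show "0 < \<theta> (i + Suc j) - \<phi>" "\<theta> (i + Suc j) - \<phi> < pi"
        using \<phi> unfolding period by auto
    qed
    then have "0 < W (Suc j) \<phi>"
      unfolding W_def by (intro prod_pos) auto
    then show "0 < (- 1) ^ Suc j * (\<Prod>i<n. cos \<phi> - c i * sin \<phi>)"
      unfolding W0 W[of _ "Suc j"] using \<kappa> by (cases "even j") simp_all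
  qed
qed

text \<open>Positivity of E off the origin gives both functions the same signs on the circle. A full
  turn contains 2 n zeros, n for each field.\<close>

lemma product_of_linear_forms_topologically_equivalent:
  fixes c :: "nat \<Rightarrow> real"
  assumes "2 \<le> n" and c: "strict_antimono_on {..<n} c"
    and E: "\<And>x y. (x, y) \<noteq> (0, 0) \<Longrightarrow> 0 < E x y"
    and f: "hyperbolic_polynomial (\<lambda>x y. E x y * (\<Prod>i<n. x - c i * y))"
  shows "topologically_equivalent (\<lambda>x y. E x y * (\<Prod>i<n. x - c i * y)) (\<lambda>x y. \<Prod>i<n. x - c i * y)"
proof -
  define R where "R = (\<lambda>x y. \<Prod>i<n. x - c i * y)"
  define f where "f = (\<lambda>x y. E x y * R x y)"
  have "c i \<noteq> c j" if "i < j" "j < n" for i j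
    using monotone_onD[OF c, of i j] that by simp
  then have "inj_on c {..<n}"
    by (intro linorder_inj_onI) auto
  then have R: "hyperbolic_polynomial R"
    unfolding R_def by (rule hyperbolic_product[OF assms(1)])
  have f: "hyperbolic_polynomial f"
    using assms(4) by (simp add: f_def R_def)
  have "0 < n"
    using assms(1) by simp
  then have "\<exists>\<theta>. strict_mono \<theta> \<and> (\<forall>j. \<theta> (j + n) = \<theta> j + pi) \<and>
      (\<forall>j. R (cos (\<theta> j)) (sin (\<theta> j)) = 0) \<and>
      (\<forall>j. \<forall>\<phi>\<in>{\<theta> j<..<\<theta> (Suc j)}. 0 < (- 1) ^ Suc j * R (cos \<phi>) (sin \<phi>))"
    unfolding R_def by (rule product_of_linear_forms_signs[OF _ c])
  then obtain \<theta> where mono: "strict_mono \<theta>"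
    and period: "\<forall>j. \<theta> (j + n) = \<theta> j + pi"
    and zero: "\<forall>j. R (cos (\<theta> j)) (sin (\<theta> j)) = 0"
    and sign: "\<forall>j. \<forall>\<phi>\<in>{\<theta> j<..<\<theta> (Suc j)}. 0 < (- 1) ^ Suc j * R (cos \<phi>) (sin \<phi>)"
    by (elim exE conjE) (rule that)
  have period2: "\<theta> (j + 2 * n) = \<theta> j + 2 * pi" for j
  proof -
    have "j + 2 * n = j + n + n"
      by simp
    then have "\<theta> (j + 2 * n) = \<theta> j + pi + pi"
      by (simp only: period)
    then show ?thesis
      by simp
  qed
  have "(cos \<phi>, sin \<phi>) \<noteq> (0, 0)" for \<phi> :: real
    using sin_zero_abs_cos_one[of \<phi>] by auto
  then have "0 < E (cos \<phi>) (sin \<phi>)" for \<phi>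
    by (rule E)
  then have sgn: "sgn (f (cos \<phi>) (sin \<phi>)) = sgn (R (cos \<phi>) (sin \<phi>))" for \<phi>
    by (simp add: f_def sgn_mult)
  have pos: "0 < R (cos \<phi>) (sin \<phi>)" if "\<phi> \<in> {\<theta> (2 * i + 1)<..<\<theta> (2 * i + 2)}" for i \<phi>
    using sign[rule_format, of \<phi> "2 * i + 1"] that by simp
  have neg: "R (cos \<phi>) (sin \<phi>) < 0" if "\<phi> \<in> {\<theta> (2 * i)<..<\<theta> (2 * i + 1)}" for i \<phi>
    using sign[rule_format, of \<phi> "2 * i"] that by simp
  note less = strict_mono_less[OF mono]
  \<comment> \<open>The product is negative just after \<open>\<theta> 0\<close>, so it turns
    positive at the odd indices; the even ones serve - R, hence the second field.\<close>
  have alt: "alternating_zeros R n (\<lambda>i. \<theta> (2 * i + 1)) (\<lambda>i. \<theta> (2 * i + 2))"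
    unfolding alternating_zeros_def
  proof (intro conjI allI ballI)
    show "\<theta> (2 * n + 1) = \<theta> (2 * 0 + 1) + 2 * pi"
      using period2[of 1] by (simp add: add.commute)
    show "R (cos \<phi>) (sin \<phi>) < 0" if "\<phi> \<in> {\<theta> (2 * i + 2)<..<\<theta> (2 * Suc i + 1)}" for i \<phi>
      using neg[of \<phi> "Suc i"] that by simp
    show "0 < R (cos \<phi>) (sin \<phi>)" if "\<phi> \<in> {\<theta> (2 * i + 1)<..<\<theta> (2 * i + 2)}" for i \<phi>
      using that by (rule pos)
  qed (simp_all add: zero strict_mono_def less)
  have alt': "alternating_zeros (\<lambda>x y. - R x y) n (\<lambda>i. \<theta> (2 * i)) (\<lambda>i. \<theta> (2 * i + 1))"
    unfolding alternating_zeros_def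
  proof (intro conjI allI ballI)
    show "\<theta> (2 * n) = \<theta> (2 * 0) + 2 * pi"
      using period2[of 0] by simp
    show "- R (cos \<phi>) (sin \<phi>) < 0" if "\<phi> \<in> {\<theta> (2 * i + 1)<..<\<theta> (2 * Suc i)}" for i \<phi>
      using pos[of \<phi> i] that by simp
    show "0 < - R (cos \<phi>) (sin \<phi>)" if "\<phi> \<in> {\<theta> (2 * i)<..<\<theta> (2 * i + 1)}" for i \<phi>
      using neg[OF that] by simp
  qed (simp_all add: zero strict_mono_def less)
  have "same_sectors_at_origin (asymptotic_field f) (asymptotic_field R)"
    by (rule same_sectors_asymptotic_fields[OF f R \<open>0 < n\<close> alt sgn])
  moreover have "same_sectors_at_origin
      (asymptotic_field (\<lambda>x y. - f x y)) (asymptotic_field (\<lambda>x y. - R x y))"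
    by (rule same_sectors_asymptotic_fields[OF f[THEN hyperbolic_polynomial_minus]
          R[THEN hyperbolic_polynomial_minus] \<open>0 < n\<close> alt']) (simp only: sgn_minus sgn)
  ultimately have "topologically_equivalent f R"
    unfolding topologically_equivalent_def
    using asymptotic_fields_asymptotic_field[OF f] asymptotic_fields_asymptotic_field[OF R] by blast
  then show ?thesis
    by (simp only: f_def R_def)
qed

text \<open>Lists the factors x - c y by decreasing c, from k down to - k, as the sign lemma
  requires.\<close>

lemma product_of_squares_eq:
  fixes x y :: real
  shows "x * (\<Prod>i=1..k. x\<^sup>2 - (real i)\<^sup>2 * y\<^sup>2) = (\<Prod>j<2 * k + 1. x - (real k - real j) * y)"
proof (induction k)
  case 0
  show ?case by simp
next
  case (Suc k)
  have "(\<Prod>j<2 * Suc k + 1. x - (real (Suc k) - real j) * y) =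
      (\<Prod>j<Suc (Suc (2 * k + 1)). x - (real (Suc k) - real j) * y)"
    by simp
  \<comment> \<open>The first and the last factor have c = k + 1 and c = - (k + 1); between them the
    shifted index recovers the product for k.\<close>
  also have "\<dots> = (x - real (Suc k) * y) *
      (\<Prod>j<Suc (2 * k + 1). x - (real (Suc k) - real (Suc j)) * y)"
    by (subst prod.lessThan_Suc_shift) simp
  also have "\<dots> = (x - real (Suc k) * y) *
      ((\<Prod>j<2 * k + 1. x - (real k - real j) * y) * (x + real (Suc k) * y))"
    by (simp add: algebra_simps)
  also have "\<dots> = x * (\<Prod>i=1..Suc k. x\<^sup>2 - (real i)\<^sup>2 * y\<^sup>2)"
    unfolding Suc.IH[symmetric] by (simp add: power2_eq_square algebra_simps)
  finally show ?case ..
qed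

theorem proposition2p1:
  fixes m k :: nat and E R f :: "real \<Rightarrow> real \<Rightarrow> real"
  assumes "m \<ge> 1" and "k \<ge> 1"
    and "E = (\<lambda>x y. x ^ (2 * m) + y ^ (2 * m))"
    and "R = (\<lambda>x y. x * (\<Prod>i=1..k. x\<^sup>2 - (real i)\<^sup>2 * y\<^sup>2)) \<or>
         R = (\<lambda>x y. x * (x - real (k + 1) * y) * (\<Prod>i=1..k. x\<^sup>2 - (real i)\<^sup>2 * y\<^sup>2))"
    and "f = (\<lambda>x y. E x y * R x y)"
    and "hyperbolic_polynomial f"
  shows "topologically_equivalent f R"
proof -
  have "\<exists>n\<ge>2. \<exists>K::nat. R = (\<lambda>x y. \<Prod>j<n. x - (real K - real j) * y)"
    using assms(4)
  proof
    assume "R = (\<lambda>x y. x * (\<Prod>i=1..k. x\<^sup>2 - (real i)\<^sup>2 * y\<^sup>2))"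
    then have "R = (\<lambda>x y. \<Prod>j<2 * k + 1. x - (real k - real j) * y)"
      by (simp only: product_of_squares_eq)
    then show ?thesis
      using assms(2) by (intro exI[of _ "2 * k + 1"] conjI exI[of _ k]) auto
  next
    assume R: "R = (\<lambda>x y. x * (x - real (k + 1) * y) * (\<Prod>i=1..k. x\<^sup>2 - (real i)\<^sup>2 * y\<^sup>2))"
    \<comment> \<open>The extra factor prepends c = k + 1 to the list from k down to - k.\<close>
    have "R x y = (\<Prod>j<Suc (2 * k + 1). x - (real (k + 1) - real j) * y)" for x y
    proof -
      have "R x y = (x - real (k + 1) * y) * (x * (\<Prod>i=1..k. x\<^sup>2 - (real i)\<^sup>2 * y\<^sup>2))"
        by (simp add: R)
      also have "\<dots> = (\<Prod>j<Suc (2 * k + 1). x - (real (k + 1) - real j) * y)"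
        unfolding product_of_squares_eq by (subst prod.lessThan_Suc_shift) simp
      finally show ?thesis .
    qed
    then show ?thesis
      using assms(2) by (intro exI[of _ "Suc (2 * k + 1)"] conjI exI[of _ "k + 1"]) auto
  qed
  then obtain n and K :: nat where "2 \<le> n" and R: "R = (\<lambda>x y. \<Prod>j<n. x - (real K - real j) * y)"
    by blast
  have "0 < E x y" if "(x, y) \<noteq> (0, 0)" for x y
  proof -
    have "0 \<le> x ^ (2 * m)" "0 \<le> y ^ (2 * m)" "x ^ (2 * m) \<noteq> 0 \<or> y ^ (2 * m) \<noteq> 0"
      using that assms(1) by (auto simp: power_mult)
    then show ?thesis
      unfolding assms(3) by linarith
  qed
  then show ?thesis
    using product_of_linear_forms_topologically_equivalent[OF \<open>2 \<le> n\<close>, of "\<lambda>j. real K - real j" E]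
      assms(6) unfolding assms(5) R by (simp add: monotone_on_def)
qed

end
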